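(* Let $\mathbb{P}$ be a Polish space in the class $\mathbf{P}\cup\{\mathbb{K}^{\aleph_0}\}$, let $\kappa\geq\aleph_0$ be a cardinal number, and let $\mathcal{L}$ be a $\sigma$-ideal of subsets of $\mathbb{P}$ such that $t+L\in\mathcal{L}$ whenever $L\in\mathcal{L}$ and $t\in\mathbb{P}$, and such that every nonempty open set in $\mathbb{P}$ contains a set $L\in\mathcal{L}$ with $|L|=\kappa$. Then: (i) $\mathbb{P}$ has a partition $\mathcal{P}\subset\mathcal{L}$ into $\kappa$-dense sets with $|\mathcal{P}|=\mathbf{c}$ such that all spaces in $\mathcal{P}$ are homeomorphic and $\mathcal{P}=\{x+L\mid x\in X\}$ for some $L\in\mathcal{L}$ and some $X\subset\mathbb{P}$. (ii) If $2^\kappa>\mathbf{c}$ (particularly if $\kappa=\mathbf{c}$), then $\mathbb{P}$ can also be partitioned into $\mathbf{c}$ mutually non-homeomorphic $\kappa$-dense sets lying in $\mathcal{L}$. (iii) In case that $\mathbb{P}=\mathbb{R}$ and $\kappa>\aleph_0$, the real line can be partitioned into $\mathbf{c}$ mutually non-homeomorphic dense sets of size $\kappa$ lying in $\mathcal{L}$.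
   Context: $\mathbf{c}=2^{\aleph_0}$. $\mathbf{P}$ denotes the class of all Polish spaces (separable completely metrizable spaces) without isolated points which are abelian topological groups (written additively) containing only countably many elements of finite order. $\mathbb{K}$ denotes the field with $3$ elements equipped with the discrete topology, and $\mathbb{K}^{\aleph_0}$ is the product space of countably infinitely many copies of $\mathbb{K}$, regarded as an abelian topological group under coordinatewise addition. In (iii), $\mathbb{R}$ is the topological group $(\mathbb{R},+)$ with the usual topology. A set $S\subset\mathbb{P}$ is $\kappa$-dense if and only if $|S\cap U|=\kappa$ for every nonempty open set $U\subset\mathbb{P}$. A $\sigma$-ideal in $\mathbb{P}$ is a nonempty family of subsets of $\mathbb{P}$ closed under taking subsets and under countable unions. Subsets of $\mathbb{P}$ carry the subspace topology. *)

theory Defs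
  imports "HOL-Analysis.Analysis" "HOL-Library.Numeral_Type" "HOL-Library.Disjoint_Sets"
begin

unbundle cardinal_syntax

text \<open>
  A Polish abelian group is a type of sort \<open>{polish_space, topological_ab_group_add}\<close>. The complete
  metric carried by the type class need not be translation invariant, and only its topology is
  used below. Cardinals are well-orders \<open>\<kappa>\<close> with \<open>Card_order \<kappa>\<close>; \<open>\<kappa>\<close> lives on its own type.
\<close>

definition continuum :: "(nat \<Rightarrow> bool) rel" where
  "continuum = ctwo ^c natLeq"

text \<open>
  In a type-class group, the \<open>n\<close>-fold multiple of \<open>x\<close> is the constant sum below; the neutral element
  counts as an element of finite order.
\<close>

definition in_class_P :: "'a::{polish_space, topological_ab_group_add} itself \<Rightarrow> bool" where
  "in_class_P TYPE('a) \<longleftrightarrow>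
     (\<forall>x::'a. \<not> x isolated_in UNIV) \<and>
     countable {x::'a. \<exists>n::nat. n > 0 \<and> (\<Sum>i<n. x) = 0}"

text \<open>
  The numeral type \<open>3\<close> is the ring of integers modulo 3, that is, the field with three elements.
  Equality with a concrete topological group is expressed by an isomorphism of topological groups
  (an additive homeomorphism).
\<close>

definition is_K_power_aleph0 :: "'a::{topological_space, ab_group_add} itself \<Rightarrow> bool" where
  "is_K_power_aleph0 TYPE('a) \<longleftrightarrow>
     (\<exists>f :: 'a \<Rightarrow> (nat \<Rightarrow> 3).
        homeomorphic_map euclidean (product_topology (\<lambda>_. discrete_topology UNIV) UNIV) f \<and>
        (\<forall>x y. f (x + y) = (\<lambda>n. f x n + f y n)))"

definition is_real_line :: "'a::{topological_space, ab_group_add} itself \<Rightarrow> bool" where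
  "is_real_line TYPE('a) \<longleftrightarrow>
     (\<exists>f :: 'a \<Rightarrow> real. homeomorphic_map euclidean euclidean f \<and> (\<forall>x y. f (x + y) = f x + f y))"

definition card_dense :: "'k rel \<Rightarrow> 'a::topological_space set \<Rightarrow> bool" where
  "card_dense \<kappa> S \<longleftrightarrow> (\<forall>U. open U \<and> U \<noteq> {} \<longrightarrow> |S \<inter> U| =o \<kappa>)"

text \<open>A \<open>\<sigma>\<close>-ideal need not be proper, nor is it required to contain the singletons.\<close>

definition sigma_ideal :: "'a set set \<Rightarrow> bool" where
  "sigma_ideal \<L> \<longleftrightarrow>
     \<L> \<noteq> {} \<and>
     (\<forall>A\<in>\<L>. \<forall>B. B \<subseteq> A \<longrightarrow> B \<in> \<L>) \<and>
     (\<forall>\<A>. \<A> \<subseteq> \<L> \<and> countable \<A> \<longrightarrow> \<Union>\<A> \<in> \<L>)"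

definition translation_invariant :: "'a::ab_group_add set set \<Rightarrow> bool" where
  "translation_invariant \<L> \<longleftrightarrow> (\<forall>L\<in>\<L>. \<forall>t. (+) t ` L \<in> \<L>)"

end

theory Submission
  imports Defs
begin

text \<open>
  Choose by transfinite recursion a \<open>\<kappa>\<close>-dense set \<open>B\<close> in the ideal, each new element lying outside
  a small subgroup that contains its predecessors and is closed under halving; halving has countable
  fibres in the groups considered. Then every \<open>h \<notin> B\<close> has only finitely many representations
  \<open>h = b + b\<^sub>2 - b\<^sub>1\<close> in \<open>B\<close>, so a greedy recursion tiles the group by translates of \<open>B\<close>, although
  the subgroup generated by \<open>B\<close> need not be in the ideal.

  For (ii), a set is homeomorphic to at most continuum many subsets of the space, as a continuous
  map is determined on a countable dense set, and there are \<open>2\<^sup>\<kappa>\<close> ways of handing a part of one tile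
  over to another one.

  For (iii) with \<open>\<kappa>\<close> below the continuum, tiles are exchanged in pairs so that a set becomes locally countable exactly
  on a prescribed open set. The boundary of its locally countable part is then a prescribed
  scattered set \<open>Z\<close>, and the Cantor-Bendixson ranks of the points at which \<open>Z\<close> is not locally compact
  can be made an arbitrary set of positive integers.
\<close>

subsection \<open>Cardinals\<close>

text \<open>Representations are compared through one exceptional summand \<open>m\<close>. If
  \<open>m\<close> occurs in only one of them, \<open>h \<notin> B\<close> rules out cancellation
  there, so its coefficient is 1, 2 or -1. Division by two is therefore enough and elements of order
  three do no harm, whereas in a group of exponent two the whole group is the only halving-closed
  subgroup. The exclusion of \<open>h \<in> B\<close> is natural: such an \<open>h\<close> equals
  \<open>b + h - b\<close> for every \<open>b\<close>, and in the tiling it means a point that is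
  already covered.

  The counting argument for (ii) gives nothing when \<open>2 ^ \<kappa>\<close> equals the
  continuum, which can happen for uncountable \<kappa> below the continuum. Hence (iii) rests on an
  explicit topological invariant with continuum many values. The price is density in place of
  \<kappa>-density, because each set becomes countable on a nonempty open set. For \<kappa> equal to
  the continuum, (iii) follows from (ii).\<close>

lemma continuum_ordIso: "continuum =o |UNIV :: nat set set|"
proof -
  have "continuum = |Func (UNIV::nat set) (UNIV::bool set)|"
    by (simp add: continuum_def cexp_def ctwo_def Field_natLeq Field_card_of)
  then show ?thesis
    using card_of_Pow_Func[of "UNIV::nat set"] ordIso_symmetric by (metis Pow_UNIV)
qed

lemma ctwo_cexp_ordIso: "ctwo ^c \<kappa> =o |Pow (Field \<kappa>)|"
  using card_of_Pow_Func[of "Field \<kappa>"] ordIso_symmetric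
  by (simp add: cexp_def ctwo_def Field_card_of) blast

lemma Cinfinite_card_of: "infinite A \<Longrightarrow> Cinfinite |A|"
  by (simp add: cinfinite_def Field_card_of card_of_card_order_on)

lemma countable_ordLeq: "countable A \<longleftrightarrow> |A| \<le>o |UNIV :: nat set|"
  by (metis card_of_ordLeq countable_def subset_UNIV)

lemma countable_ordLeq_infinite: "countable A \<Longrightarrow> infinite Z \<Longrightarrow> |A| \<le>o |Z|"
  using countable_ordLeq infinite_iff_card_of_nat ordLeq_transitive by blast

lemma ordLess_exists_diff: "|A| <o |B| \<Longrightarrow> \<exists>b\<in>B. b \<notin> A"
  by (metis card_of_mono1 not_ordLess_ordLeq subsetI)

text \<open>Finiteness of the pieces makes this hold for singular cardinals as well: over an
  infinite index set the union is no larger than the index set.\<close>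

lemma card_of_UN_finite_ordLess:
  assumes "|I| <o |B|" "infinite B" "\<And>i. i \<in> I \<Longrightarrow> finite (F i)"
  shows "|\<Union>i\<in>I. F i| <o |B|"
proof (cases "finite I")
  case True
  then show ?thesis using assms by (intro finite_ordLess_infinite[OF card_of_Well_order card_of_Well_order]) (auto simp: Field_card_of)
next
  case False
  have "|\<Union>i\<in>I. F i| \<le>o |I|"
    using assms(3) False
    by (intro card_of_UNION_ordLeq_infinite) (auto intro: card_of_refl ordIso_imp_ordLeq countable_ordLeq_infinite countable_finite)
  then show ?thesis using assms(1) ordLeq_ordLess_trans by blast
qed

subsection \<open>Dissociated sets and tilings of abelian groups\<close>

text \<open>These are the subgroups whose quotient has no element of order two; they settle
  equations in which an element occurs twice.\<close>

definition halving_closed :: "'a::ab_group_add set \<Rightarrow> bool" where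
  "halving_closed C \<longleftrightarrow> 0 \<in> C \<and> (\<forall>x\<in>C. \<forall>y\<in>C. x - y \<in> C) \<and> (\<forall>x. x + x \<in> C \<longrightarrow> x \<in> C)"

lemma halving_closedD:
  assumes "halving_closed C"
  shows "x \<in> C \<Longrightarrow> y \<in> C \<Longrightarrow> x - y \<in> C" "x \<in> C \<Longrightarrow> - x \<in> C"
    "x \<in> C \<Longrightarrow> y \<in> C \<Longrightarrow> x + y \<in> C" "x + x \<in> C \<Longrightarrow> x \<in> C" "0 \<in> C"
proof -
  note C = assms[unfolded halving_closed_def]
  have d: "x - y \<in> C" if "x \<in> C" "y \<in> C" for x y using C that by blast
  have z: "0 \<in> C" using C by blast
  have m: "- x \<in> C" if "x \<in> C" for x using d[OF z that] diff_0 by metis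
  have p: "x + y \<in> C" if "x \<in> C" "y \<in> C" for x y
    using d[OF that(1) m[OF that(2)]] diff_minus_eq_add by metis
  show "x \<in> C \<Longrightarrow> y \<in> C \<Longrightarrow> x - y \<in> C" by (rule d)
  show "x \<in> C \<Longrightarrow> - x \<in> C" by (rule m)
  show "x \<in> C \<Longrightarrow> y \<in> C \<Longrightarrow> x + y \<in> C" by (rule p)
  show "x + x \<in> C \<Longrightarrow> x \<in> C" using C by blast
  show "0 \<in> C" by (rule z)
qed

text \<open>Each round adds all differences and all halves. Since doubling has countable fibres, no
  round exceeds an infinite bound, and countably many rounds reach a closed set. The bound
  \<open>Z\<close> is kept apart from \<open>Y\<close> so that a finite \<open>Y\<close> gets a
  countable closure.\<close>

lemma halving_closure_exists:
  fixes Y :: "'a::ab_group_add set" and Z :: "'z set"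
  assumes half: "\<And>y::'a. countable {x. x + x = y}"
    and Z: "infinite Z" and Y: "|Y| \<le>o |Z|"
  shows "\<exists>C. Y \<subseteq> C \<and> halving_closed C \<and> |C| \<le>o |Z|"
proof -
  define G where "G = rec_nat (insert 0 Y)
    (\<lambda>n A. A \<union> (\<lambda>(x, y). x - y) ` (A \<times> A) \<union> (\<Union>y\<in>A. {x. x + x = y}))"
  have G0: "G 0 = insert 0 Y"
    and GS: "G (Suc n) = G n \<union> (\<lambda>(x, y). x - y) ` (G n \<times> G n) \<union> (\<Union>y\<in>G n. {x. x + x = y})" for n
    by (simp_all add: G_def)
  have mono: "G m \<subseteq> G n" if "m \<le> n" for m n
    using that by (rule lift_Suc_mono_le[rotated]) (auto simp: GS)
  have cZ: "Cinfinite |Z|" using Z by (rule Cinfinite_card_of)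
  have card: "|G n| \<le>o |Z|" for n
  proof (induction n)
    case 0
    have "|{0::'a}| \<le>o |Z|" by (rule countable_ordLeq_infinite[OF _ Z]) simp
    then have "|{0} \<union> Y| \<le>o |Z|" using Y cZ by (intro Un_Cinfinite_bound)
    then show ?case by (simp add: G0)
  next
    case (Suc n)
    have "|(\<lambda>(x, y). x - y) ` (G n \<times> G n)| \<le>o |G n \<times> G n|" by (rule card_of_image)
    moreover have "|G n \<times> G n| \<le>o |Z|"
      using Suc cZ card_of_Times_ordLeq_infinite_Field[of "|Z|" "G n" "G n"]
      by (simp add: cinfinite_def)
    moreover have "|\<Union>y\<in>G n. {x. x + x = y}| \<le>o |Z|"
      using Suc cZ by (intro UNION_Cinfinite_bound) (auto intro!: countable_ordLeq_infinite half Z)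
    ultimately show ?case
      unfolding GS using Suc cZ by (intro Un_Cinfinite_bound) (auto intro: ordLeq_transitive)
  qed
  define C where "C = (\<Union>n. G n)"
  have "|C| \<le>o |Z|" unfolding C_def
    using card cZ by (intro UNION_Cinfinite_bound) (auto intro!: countable_ordLeq_infinite Z)
  moreover have "Y \<subseteq> C" using G0 by (auto simp: C_def)
  moreover have "halving_closed C"
    unfolding halving_closed_def
  proof (intro conjI ballI allI impI)
    show "0 \<in> C" using G0 by (auto simp: C_def)
  next
    fix x y assume "x \<in> C" "y \<in> C"
    then obtain m n where "x \<in> G m" "y \<in> G n" by (auto simp: C_def)
    then have "x \<in> G (max m n)" "y \<in> G (max m n)" using mono by (meson max.cobounded1 max.cobounded2 subsetD)+
    then have "x - y \<in> G (Suc (max m n))" by (auto simp: GS)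
    then show "x - y \<in> C" by (auto simp: C_def)
  next
    fix x assume "x + x \<in> C"
    then obtain n where "x + x \<in> G n" by (auto simp: C_def)
    then have "x \<in> G (Suc n)" by (auto simp: GS)
    then show "x \<in> C" by (auto simp: C_def)
  qed
  ultimately show ?thesis by blast
qed

text \<open>A weak form of independence: each finite part has one member independent of the others.
  A recursive choice supplies it as the member chosen last.\<close>

definition dissociated :: "'a::ab_group_add set \<Rightarrow> bool" where
  "dissociated B \<longleftrightarrow>
     (\<forall>Y\<subseteq>B. finite Y \<and> Y \<noteq> {} \<longrightarrow> (\<exists>m\<in>Y. \<exists>C. halving_closed C \<and> Y - {m} \<subseteq> C \<and> m \<notin> C))"

lemma dissociatedE:
  assumes "dissociated B" "Y \<subseteq> B" "finite Y" "Y \<noteq> {}"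
  obtains m C where "m \<in> Y" "halving_closed C" "\<And>y. y \<in> Y \<Longrightarrow> y \<noteq> m \<Longrightarrow> y \<in> C" "m \<notin> C"
proof -
  obtain m C where "m \<in> Y" "halving_closed C" "Y - {m} \<subseteq> C" "m \<notin> C"
    using assms unfolding dissociated_def by meson
  then show ?thesis using that by auto
qed

section \<open>Recursive construction of dissociated sets\<close>

lemma strict_card_order:
  fixes J :: "'j set"
  shows "\<exists>R. wf R \<and> trans R \<and> (\<forall>x\<in>J. \<forall>y\<in>J. x \<noteq> y \<longrightarrow> (x, y) \<in> R \<or> (y, x) \<in> R) \<and>
    (\<forall>x\<in>J. |{z. (z, x) \<in> R}| <o |J| ) \<and> R \<subseteq> J \<times> J"
proof -
  define r where "r = |J|"
  have wo: "well_order_on J r" unfolding r_def by (rule card_of_well_order_on)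
  have F: "Field r = J" by (simp add: r_def Field_card_of)
  show ?thesis
  proof (intro exI[of _ "r - Id"] conjI ballI impI)
    show "wf (r - Id)" using wo by (simp add: well_order_on_def)
    show "trans (r - Id)"
      using wo by (intro trans_diff_Id) (auto simp: well_order_on_def linear_order_on_def partial_order_on_def preorder_on_def)
    show "(x, y) \<in> r - Id \<or> (y, x) \<in> r - Id" if "x \<in> J" "y \<in> J" "x \<noteq> y" for x y
      using wo that by (auto simp: well_order_on_def linear_order_on_def total_on_def)
    show "|{z. (z, x) \<in> r - Id}| <o |J|" if "x \<in> J" for x
    proof -
      have "{z. (z, x) \<in> r - Id} = underS r x" by (auto simp: underS_def)
      then show ?thesis using card_of_underS[of r x] that F by (simp add: r_def card_of_Card_order)
    qed
    show "r - Id \<subseteq> J \<times> J" using F by (auto simp: Field_def)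
  qed
qed

lemma finite_has_maximum:
  assumes "finite I" "I \<noteq> {}" "trans R"
    and "\<And>x y. x \<in> I \<Longrightarrow> y \<in> I \<Longrightarrow> x \<noteq> y \<Longrightarrow> (x, y) \<in> R \<or> (y, x) \<in> R"
  shows "\<exists>m\<in>I. \<forall>z\<in>I. z \<noteq> m \<longrightarrow> (z, m) \<in> R"
  using assms(1,2,4)
proof (induction I rule: finite_ne_induct)
  case (singleton x)
  then show ?case by simp
next
  case (insert x F)
  then obtain m where m: "m \<in> F" "\<forall>z\<in>F. z \<noteq> m \<longrightarrow> (z, m) \<in> R" by auto
  show ?case
  proof (cases "(x, m) \<in> R")
    case True
    then show ?thesis using m by auto
  next
    case False
    then have "(m, x) \<in> R" using insert m by (metis insertCI)
    then show ?thesis using m assms(3) by (metis insert_iff transD)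
  qed
qed

text \<open>At stage \<open>x\<close> the earlier values lie in a closed subgroup smaller than
  \<open>W x\<close>, so a value outside it can be chosen. With finitely many predecessors that
  subgroup is countable and \<open>W x\<close> is uncountable; otherwise it is no larger than the
  set of predecessors, hence smaller than \<open>J\<close>.\<close>

lemma dissociated_family_exists:
  fixes J :: "'j set" and W :: "'j \<Rightarrow> 'a::ab_group_add set"
  assumes half: "\<And>y::'a. countable {x. x + x = y}"
    and J: "\<And>j. j \<in> J \<Longrightarrow> |J| \<le>o |W j|" "\<And>j. j \<in> J \<Longrightarrow> uncountable (W j)"
  obtains f where "inj_on f J" "\<And>j. j \<in> J \<Longrightarrow> f j \<in> W j" "dissociated (f ` J)"
proof -
  obtain R where R: "wf R" "trans R" "\<And>x y. x \<in> J \<Longrightarrow> y \<in> J \<Longrightarrow> x \<noteq> y \<Longrightarrow> (x, y) \<in> R \<or> (y, x) \<in> R"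
    "\<And>x. x \<in> J \<Longrightarrow> |{z. (z, x) \<in> R}| <o |J|" "R \<subseteq> J \<times> J"
    using strict_card_order[of J] by metis
  define P where "P = (\<lambda>f x y. x \<in> J \<longrightarrow>
    y \<in> W x \<and> (\<exists>C. halving_closed C \<and> f ` {z. (z, x) \<in> R} \<subseteq> C \<and> y \<notin> C))"
  have "\<exists>f. \<forall>x. P f x (f x)"
  proof (rule dependent_wf_choice[OF R(1)])
    fix f g :: "'j \<Rightarrow> 'a" and x y
    assume "\<And>z. (z, x) \<in> R \<Longrightarrow> f z = g z"
    then have "f ` {z. (z, x) \<in> R} = g ` {z. (z, x) \<in> R}" by auto
    then show "P f x y = P g x y" by (simp add: P_def)
  next
    fix x and f :: "'j \<Rightarrow> 'a"
    show "\<exists>y. P f x y"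
    proof (cases "x \<in> J")
      case True
      let ?U = "{z. (z, x) \<in> R}"
      have U: "|?U| <o |J|" using R(4) True by blast
      have img: "|f ` ?U| \<le>o |?U|" by (rule card_of_image)
      have "\<exists>C. f ` ?U \<subseteq> C \<and> halving_closed C \<and> |C| <o |W x|"
      proof (cases "finite ?U")
        case True
        then obtain C where C: "f ` ?U \<subseteq> C" "halving_closed C" "|C| \<le>o |UNIV :: nat set|"
          using halving_closure_exists[OF half, of "UNIV::nat set" "f ` ?U"]
          by (metis countable_finite countable_ordLeq finite_imageI infinite_UNIV_nat)
        have "\<not> |W x| \<le>o |C|"
          using C(3) J(2)[OF \<open>x \<in> J\<close>] countable_ordLeq ordLeq_transitive by blast
        then show ?thesis using C by (meson card_of_Well_order not_ordLeq_iff_ordLess)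
      next
        case False
        then obtain C where "f ` ?U \<subseteq> C" "halving_closed C" "|C| \<le>o |?U|"
          using halving_closure_exists[OF half False img] by blast
        then show ?thesis
          using U J(1)[OF \<open>x \<in> J\<close>] by (meson ordLeq_ordLess_trans ordLess_ordLeq_trans)
      qed
      then obtain C where C: "f ` ?U \<subseteq> C" "halving_closed C" "|C| <o |W x|" by blast
      then obtain y where "y \<in> W x" "y \<notin> C" using ordLess_exists_diff by blast
      then show ?thesis using C by (auto simp: P_def)
    qed (simp add: P_def)
  qed
  then obtain f where f: "\<And>x. P f x (f x)" by blast
  have sep: "\<exists>C. halving_closed C \<and> f ` {z. (z, x) \<in> R} \<subseteq> C \<and> f x \<notin> C" if "x \<in> J" for x
    using f[of x] that by (auto simp: P_def)
  have neq: "f x \<noteq> f y" if "(x, y) \<in> R" for x y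
  proof -
    have "y \<in> J" using R(5) that by auto
    then obtain C where C: "f ` {z. (z, y) \<in> R} \<subseteq> C" "f y \<notin> C" using sep by blast
    have "f x \<in> C" using C(1) that by auto
    then show ?thesis using C(2) by metis
  qed
  show ?thesis
  proof (rule that)
    show "inj_on f J" using neq R(3) by (metis inj_onI)
    show "f j \<in> W j" if "j \<in> J" for j using f[of j] that by (auto simp: P_def)
    show "dissociated (f ` J)"
      unfolding dissociated_def
    proof (intro allI impI)
      fix Y assume Y: "Y \<subseteq> f ` J" "finite Y \<and> Y \<noteq> {}"
      then obtain I where I: "I \<subseteq> J" "finite I" "Y = f ` I" by (meson finite_subset_image)
      \<comment> \<open>The index that comes last in \<open>R\<close> yields the exceptional
        element: its closed set contains every earlier value.\<close>
      have "\<exists>m\<in>I. \<forall>z\<in>I. z \<noteq> m \<longrightarrow> (z, m) \<in> R"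
      proof (rule finite_has_maximum[OF I(2) _ R(2)])
        show "I \<noteq> {}" using Y I(3) by blast
      qed (use R(3) I(1) in blast)
      then obtain m where m: "m \<in> I" "\<forall>z\<in>I. z \<noteq> m \<longrightarrow> (z, m) \<in> R" by blast
      then obtain C where C: "halving_closed C" "f ` {z. (z, m) \<in> R} \<subseteq> C" "f m \<notin> C"
        using sep I by blast
      have "Y - {f m} \<subseteq> C"
      proof
        fix y assume "y \<in> Y - {f m}"
        then obtain z where "z \<in> I" "y = f z" "z \<noteq> m" using I(3) by auto
        then show "y \<in> C" using m(2) C(2) by auto
      qed
      moreover have "f m \<in> Y" using m(1) I(3) by simp
      ultimately show "\<exists>m\<in>Y. \<exists>C. halving_closed C \<and> Y - {m} \<subseteq> C \<and> m \<notin> C"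
        using C(1,3) by metis
    qed
  qed
qed

text \<open>If the exceptional element occurred on one side only, solving for it or for its double
  would put it into the closed set of the others. So both sides share it, and cancelling it
  identifies the remaining summands.\<close>

lemma dissociated_sum_unique:
  assumes B: "dissociated B" "a \<in> B" "b \<in> B" "c \<in> B" "d \<in> B" and eq: "a + b = c + d"
  shows "{a, b} = {c, d}"
proof -
  obtain m C where m: "m \<in> {a, b, c, d}" "halving_closed C"
    "\<And>y. y \<in> {a, b, c, d} \<Longrightarrow> y \<noteq> m \<Longrightarrow> y \<in> C" "m \<notin> C"
    by (rule dissociatedE[OF B(1), of "{a, b, c, d}"]) (use B in auto)
  note C = halving_closedD[OF m(2)]
  have key: "m \<in> {r, s}" if eq': "p + q = r + s" and mem: "m \<in> {p, q}" and "{p, q, r, s} \<subseteq> {a, b, c, d}" for p q r s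
  proof (rule ccontr)
    assume "m \<notin> {r, s}"
    then have rs: "r + s \<in> C" using that m(3) C(3) by auto
    have "p \<in> C \<or> p = m" "q \<in> C \<or> q = m" using m(3) that(3) by blast+
    then consider "p = m" "q = m" | "p = m" "q \<in> C" | "q = m" "p \<in> C" using mem by blast
    then show False
    proof cases
      case 1
      then have "m + m \<in> C" using rs eq' by metis
      then show ?thesis using C(4) m(4) by blast
    next
      case 2
      then have "m = (p + q) - q" by simp
      then show ?thesis using C(1)[OF rs 2(2)] m(4) eq' by metis
    next
      case 3
      then have "m = (p + q) - p" by simp
      then show ?thesis using C(1)[OF rs 3(2)] m(4) eq' by metis
    qed
  qed
  have "m \<in> {a, b} \<and> m \<in> {c, d}"
    using key[of a b c d] key[of c d a b] eq m(1) by auto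
  then show ?thesis using eq by (auto simp: add.commute)
qed

lemma dissociated_finite_sums:
  assumes B: "dissociated B"
  shows "finite {b \<in> B. \<exists>b2\<in>B. g = b + b2}"
proof (cases "{b \<in> B. \<exists>b2\<in>B. g = b + b2} = {}")
  case False
  then obtain d d1 where d: "d \<in> B" "d1 \<in> B" "g = d + d1" by auto
  have "b \<in> {d, d1}" if "b \<in> B" "b2 \<in> B" "g = b + b2" for b b2
    using dissociated_sum_unique[OF B] that d by (metis insertI1)
  then have "{b \<in> B. \<exists>b2\<in>B. g = b + b2} \<subseteq> {d, d1}" by blast
  then show ?thesis using finite_subset by blast
qed (metis finite.emptyI)

text \<open>Any two representations \<open>h = b + b\<^sub>2 - b\<^sub>1\<close> share a summand, since otherwise the
  exceptional element of their six summands would lie in a closed set not containing it.\<close>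
lemma dissociated_finite_representations:
  assumes B: "dissociated B" and h: "h \<notin> B"
  shows "finite {b \<in> B. \<exists>b1\<in>B. \<exists>b2\<in>B. h = b + b2 - b1}" (is "finite ?R")
proof (cases "?R = {}")
  case False
  then obtain c c1 c2 where c: "c \<in> B" "c1 \<in> B" "c2 \<in> B" "h = c + c2 - c1" by auto
  have f1: "finite {b \<in> B. \<exists>b1\<in>B. b1 \<noteq> b \<and> g = b - b1}" for g
  proof (cases "{b \<in> B. \<exists>b1\<in>B. b1 \<noteq> b \<and> g = b - b1} = {}")
    case False
    then obtain d d1 where d: "d \<in> B" "d1 \<in> B" "d1 \<noteq> d" "g = d - d1" by auto
    have "b = d" if "b \<in> B" "b1 \<in> B" "b1 \<noteq> b" "g = b - b1" for b b1
    proof -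
      \<comment> \<open>Moving the subtracted terms across turns equal differences into equal sums;
        \<open>b1 \<noteq> b\<close> then leaves only \<open>b = d\<close>.\<close>
      have "b + d1 = d + b1" using that d by (metis add_diff_eq diff_add_cancel diff_add_eq)
      then have "{b, d1} = {d, b1}" using dissociated_sum_unique[OF B] that d by blast
      then show ?thesis using that d by auto
    qed
    then have "{b \<in> B. \<exists>b1\<in>B. b1 \<noteq> b \<and> g = b - b1} \<subseteq> {d}" by auto
    then show ?thesis using finite_subset by blast
  qed (metis finite.emptyI)
  note f2 = dissociated_finite_sums[OF B]
  \<comment> \<open>Every representation shares a summand with the fixed one. Either that is
    \<open>b\<close>, or removing it leaves a difference of distinct elements or a sum of two
    elements, with finitely many possible \<open>b\<close>.\<close>
  define M where "M = {c, c1, c2}"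
  have "b \<in> (\<Union>m\<in>M. {m} \<union> {b \<in> B. \<exists>b1\<in>B. b1 \<noteq> b \<and> h - m = b - b1} \<union> {b \<in> B. \<exists>b2\<in>B. h + m = b + b2})"
    if b: "b \<in> B" "b1 \<in> B" "b2 \<in> B" "h = b + b2 - b1" for b b1 b2
  proof -
    obtain m C where m: "m \<in> {c, c1, c2, b, b1, b2}" "halving_closed C"
      "\<And>y. y \<in> {c, c1, c2, b, b1, b2} \<Longrightarrow> y \<noteq> m \<Longrightarrow> y \<in> C" "m \<notin> C"
      by (rule dissociatedE[OF B, of "{c, c1, c2, b, b1, b2}"]) (use b(1-3) c(1-3) in auto)
    note C = halving_closedD[OF m(2)]
    have key: "h \<notin> C" if mem: "m \<in> {p, q, r}" and "{p, q, r} \<subseteq> {c, c1, c2, b, b1, b2}" "{p, q, r} \<subseteq> B"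
      and eq': "h = p + q - r" for p q r
    proof
      assume hC: "h \<in> C"
      \<comment> \<open>Equality would cancel and put \<open>h\<close> into \<open>B\<close>; this
        leaves four cases for the occurrences of \<open>m\<close>.\<close>
      have ne: "p \<noteq> r" "q \<noteq> r" using eq' that(3) h by auto
      have "p \<in> C \<or> p = m" "q \<in> C \<or> q = m" "r \<in> C \<or> r = m" using m(3) that(2) by blast+
      then consider "p = m" "q = m" "r \<in> C" | "p = m" "q \<in> C" "r \<in> C" | "p \<in> C" "q = m" "r \<in> C"
        | "p \<in> C" "q \<in> C" "r = m" using mem ne by blast
      then show False
      proof cases
        case 1
        then have "m + m = h + r" using eq' by simp
        then have "m + m \<in> C" using C(3)[OF hC 1(3)] by metis
        then show ?thesis using C(4) m(4) by blast
      next
        case 2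
        then have "m = h + r - q" using eq' by simp
        then show ?thesis using C(1)[OF C(3)[OF hC 2(3)] 2(2)] m(4) by metis
      next
        case 3
        then have "m = h + r - p" using eq' by simp
        then show ?thesis using C(1)[OF C(3)[OF hC 3(3)] 3(1)] m(4) by metis
      next
        case 4
        then have "m = p + q - h" using eq' by simp
        then show ?thesis using C(1)[OF C(3)[OF 4(1,2)] hC] m(4) by metis
      qed
    qed
    have inC: "h \<in> C" if "m \<notin> {p, q, r}" "{p, q, r} \<subseteq> {c, c1, c2, b, b1, b2}" "h = p + q - r" for p q r
    proof -
      have "p \<in> C" "q \<in> C" "r \<in> C" using that(1,2) m(3) by blast+
      then show ?thesis unfolding that(3) using C(1,3) by blast
    qed
    have "{c, c2, c1} \<subseteq> {c, c1, c2, b, b1, b2}" "{b, b2, b1} \<subseteq> {c, c1, c2, b, b1, b2}"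
      "{c, c2, c1} \<subseteq> B" "{b, b2, b1} \<subseteq> B" using b(1-3) c(1-3) by auto
    \<comment> \<open>A triple contains \<open>m\<close> exactly when \<open>h\<close> is outside
      \<open>C\<close>. Hence \<open>m\<close>, being in one of the triples, is in both.\<close>
    then have "(m \<in> {c, c2, c1} \<longrightarrow> h \<notin> C) \<and> (m \<in> {b, b2, b1} \<longrightarrow> h \<notin> C)"
      "(m \<notin> {c, c2, c1} \<longrightarrow> h \<in> C) \<and> (m \<notin> {b, b2, b1} \<longrightarrow> h \<in> C)"
      using key[of c c2 c1, OF _ _ _ c(4)] key[of b b2 b1, OF _ _ _ b(4)]
        inC[of c c2 c1, OF _ _ c(4)] inC[of b b2 b1, OF _ _ b(4)] by blast+
    then have "m \<in> {c, c2, c1} \<and> m \<in> {b, b2, b1}"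
      using m(1) by auto
    then consider "m \<in> M" "m = b" | "m \<in> M" "m = b2" | "m \<in> M" "m = b1" by (auto simp: M_def)
    then show ?thesis
    proof cases
      case 1 then show ?thesis by auto
    next
      case 2
      have "b1 \<noteq> b" "h - m = b - b1" using b(3,4) h 2 by auto
      then have "b \<in> {b \<in> B. \<exists>b1\<in>B. b1 \<noteq> b \<and> h - m = b - b1}" using b(1,2) by blast
      then show ?thesis using 2 by blast
    next
      case 3
      then have "h + m = b + b2" using b(4) by simp
      then have "b \<in> {b \<in> B. \<exists>b2\<in>B. h + m = b + b2}" using b(1,3) by blast
      then show ?thesis using 3 by blast
    qed
  qed
  then have "?R \<subseteq> (\<Union>m\<in>M. {m} \<union> {b \<in> B. \<exists>b1\<in>B. b1 \<noteq> b \<and> h - m = b - b1} \<union> {b \<in> B. \<exists>b2\<in>B. h + m = b + b2})"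
    by blast
  moreover have "finite \<dots>" using f1 f2 by (auto simp: M_def)
  ultimately show ?thesis using finite_subset by blast
qed (metis finite.emptyI)

text \<open>An uncovered \<open>h\<close> gets the tile at \<open>h - b\<close>. It meets an earlier
  tile at \<open>x\<close> only if \<open>h - x = b + b1 - b2\<close> for some \<open>b1\<close>,
  \<open>b2\<close> in \<open>B\<close>. As \<open>h - x \<notin> B\<close>, each earlier
  \<open>x\<close> excludes finitely many \<open>b\<close>, and there are fewer than
  \<open>|B|\<close> earlier tiles.\<close>

lemma tile_subgroup:
  fixes B H :: "'a::ab_group_add set"
  assumes B: "infinite B" "B \<subseteq> H" "|H| =o |B|"
    and diff: "\<And>x y. x \<in> H \<Longrightarrow> y \<in> H \<Longrightarrow> x - y \<in> H"
    and fin: "\<And>h. h \<notin> B \<Longrightarrow> finite {b \<in> B. \<exists>b1\<in>B. \<exists>b2\<in>B. h = b + b2 - b1}"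
  obtains X where "X \<subseteq> H" "\<And>h. h \<in> H \<Longrightarrow> \<exists>!x. x \<in> X \<and> h - x \<in> B"
proof -
  obtain R where R: "wf R" "trans R" "\<And>x y. x \<in> H \<Longrightarrow> y \<in> H \<Longrightarrow> x \<noteq> y \<Longrightarrow> (x, y) \<in> R \<or> (y, x) \<in> R"
    "\<And>x. x \<in> H \<Longrightarrow> |{z. (z, x) \<in> R}| <o |H|" "R \<subseteq> H \<times> H"
    using strict_card_order[of H] by metis
  define pr where "pr = (\<lambda>(f::'a \<Rightarrow> 'a option) h. {x. \<exists>z. (z, h) \<in> R \<and> f z = Some x})"
  \<comment> \<open>The value \<open>None\<close> marks an \<open>h\<close> outside \<open>H\<close>
    or already covered when its turn comes; no tile is placed for it.\<close>
  define P where "P = (\<lambda>f h y. 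
    if h \<notin> H \<or> (\<exists>x\<in>pr f h. h - x \<in> B) then y = None
    else \<exists>b\<in>B. y = Some (h - b) \<and> (\<forall>x\<in>pr f h. \<forall>b1\<in>B. \<forall>b2\<in>B. h - b + b2 \<noteq> x + b1))"
  have "\<exists>f. \<forall>x. P f x (f x)"
  proof (rule dependent_wf_choice[OF R(1)])
    fix f g :: "'a \<Rightarrow> 'a option" and h y
    assume "\<And>z. (z, h) \<in> R \<Longrightarrow> f z = g z"
    then have "pr f h = pr g h" by (auto simp: pr_def)
    then show "P f h y = P g h y" by (simp add: P_def)
  next
    fix h and f :: "'a \<Rightarrow> 'a option"
    show "\<exists>y. P f h y"
    proof (cases "h \<notin> H \<or> (\<exists>x\<in>pr f h. h - x \<in> B)")
      case False
      then have h: "h \<in> H" and nB: "\<And>x. x \<in> pr f h \<Longrightarrow> h - x \<notin> B" by auto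
      have "pr f h \<subseteq> (\<lambda>z. the (f z)) ` {z. (z, h) \<in> R}" by (force simp: pr_def)
      then have "|pr f h| \<le>o |{z. (z, h) \<in> R}|" by (metis card_of_image card_of_mono1 ordLeq_transitive)
      then have "|pr f h| <o |B|"
        using R(4)[OF h] B(3) by (meson ordLeq_ordLess_trans ordLess_ordIso_trans)
      then have "|\<Union>x\<in>pr f h. {b \<in> B. \<exists>b1\<in>B. \<exists>b2\<in>B. h - x = b + b2 - b1}| <o |B|"
        using nB fin B(1) by (intro card_of_UN_finite_ordLess) auto
      then obtain b where b: "b \<in> B" "b \<notin> (\<Union>x\<in>pr f h. {b \<in> B. \<exists>b1\<in>B. \<exists>b2\<in>B. h - x = b + b2 - b1})"
        using ordLess_exists_diff by blast
      have "\<forall>x\<in>pr f h. \<forall>b1\<in>B. \<forall>b2\<in>B. h - b + b2 \<noteq> x + b1"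
      proof (intro ballI notI)
        fix x b1 b2 assume *: "x \<in> pr f h" "b1 \<in> B" "b2 \<in> B" "h - b + b2 = x + b1"
        then have "h - x = b + b1 - b2" by (simp add: algebra_simps)
        then show False using * b by blast
      qed
      then show ?thesis using False b(1) by (auto simp: P_def)
    qed (simp add: P_def)
  qed
  then obtain f where f: "\<And>x. P f x (f x)" by blast
  define X where "X = {x. \<exists>h\<in>H. f h = Some x}"
  have prX: "pr f h \<subseteq> X" for h using R(5) by (auto simp: pr_def X_def)
  have some: "\<exists>b\<in>B. y = h - b \<and> (\<forall>x\<in>pr f h. \<forall>b1\<in>B. \<forall>b2\<in>B. h - b + b2 \<noteq> x + b1)"
    if "f h = Some y" "h \<in> H" for h y
    using f[of h] that by (auto simp: P_def split: if_splits)
  show ?thesis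
  proof (rule that)
    show "X \<subseteq> H"
    proof
      fix x assume "x \<in> X"
      then obtain h where "h \<in> H" "f h = Some x" by (auto simp: X_def)
      then obtain b where "b \<in> B" "x = h - b" using some by blast
      then show "x \<in> H" using diff B(2) \<open>h \<in> H\<close> by blast
    qed
    fix h assume h: "h \<in> H"
    have ex: "\<exists>x. x \<in> X \<and> h - x \<in> B"
    proof (cases "\<exists>x\<in>pr f h. h - x \<in> B")
      case True
      then show ?thesis using prX by blast
    next
      case False
      then obtain b where "b \<in> B" "f h = Some (h - b)" using f[of h] h by (auto simp: P_def)
      then show ?thesis using h by (intro exI[of _ "h - b"]) (auto simp: X_def)
    qed
    have no: False if h12: "(h1, h2) \<in> R" "f h2 = Some y" "f h1 = Some x" "h - x \<in> B" "h - y \<in> B" for h1 h2 x y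
    proof -
      have "h2 \<in> H" "x \<in> pr f h2" using that R(5) by (auto simp: pr_def)
      then obtain b where "y = h2 - b" "\<forall>x\<in>pr f h2. \<forall>b1\<in>B. \<forall>b2\<in>B. h2 - b + b2 \<noteq> x + b1"
        using some h12(2) by blast
      then have "y + (h - y) \<noteq> x + (h - x)" using that \<open>x \<in> pr f h2\<close> by blast
      then show False by simp
    qed
    show "\<exists>!x. x \<in> X \<and> h - x \<in> B"
    proof (rule ex_ex1I[OF ex])
      fix x y assume xy: "x \<in> X \<and> h - x \<in> B" "y \<in> X \<and> h - y \<in> B"
      then obtain h1 h2 where h12: "h1 \<in> H" "f h1 = Some x" "h2 \<in> H" "f h2 = Some y" by (auto simp: X_def)
      then show "x = y" using no[of h1 h2 y x] no[of h2 h1 x y] R(3)[of h1 h2] xy by fastforce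
    qed
  qed
qed

text \<open>One translated copy of the tiling of \<open>H\<close> is put into each coset.\<close>

lemma tile_group:
  fixes B H X :: "'a::ab_group_add set"
  assumes H: "0 \<in> H" "\<And>x y. x \<in> H \<Longrightarrow> y \<in> H \<Longrightarrow> x - y \<in> H"
    and B: "B \<subseteq> H" and X: "X \<subseteq> H" "\<And>h. h \<in> H \<Longrightarrow> \<exists>!x. x \<in> X \<and> h - x \<in> B"
  obtains X' where "\<And>h::'a. \<exists>!x. x \<in> X' \<and> h - x \<in> B"
proof -
  \<comment> \<open>Elements of one coset give the same predicate under \<open>SOME\<close>, so
    \<open>\<rho>\<close> selects one representative per coset.\<close>
  define \<rho> where "\<rho> = (\<lambda>p. SOME q. p - q \<in> H)"
  have plus: "x + y \<in> H" if "x \<in> H" "y \<in> H" for x y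
    using H(2)[OF that(1) H(2)[OF H(1) that(2)]] by simp
  have \<rho>: "p - \<rho> p \<in> H" for p unfolding \<rho>_def by (rule someI[of _ p]) (simp add: H(1))
  have cong: "\<rho> p = \<rho> q" if "p - q \<in> H" for p q
  proof -
    have "(p - z \<in> H) = (q - z \<in> H)" for z
      using H(2)[OF _ that, of "p - z"] plus[OF _ that, of "q - z"] by (auto simp: algebra_simps)
    then show ?thesis by (simp add: \<rho>_def)
  qed
  show ?thesis
  proof (rule that[of "{\<rho> p + x |p x. x \<in> X}"])
    fix h
    obtain x where x: "x \<in> X" "h - \<rho> h - x \<in> B" "\<And>y. y \<in> X \<Longrightarrow> h - \<rho> h - y \<in> B \<Longrightarrow> y = x"
      using X(2)[OF \<rho>[of h]] by blast
    show "\<exists>!y. y \<in> {\<rho> p + x |p x. x \<in> X} \<and> h - y \<in> B"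
    proof (rule ex1I[of _ "\<rho> h + x"])
      show "\<rho> h + x \<in> {\<rho> p + x |p x. x \<in> X} \<and> h - (\<rho> h + x) \<in> B"
        using x(1,2) by (auto simp: diff_diff_eq)
      fix y assume "y \<in> {\<rho> p + x |p x. x \<in> X} \<and> h - y \<in> B"
      then obtain p z where y: "y = \<rho> p + z" "z \<in> X" "h - y \<in> B" by blast
      have "h - p = (h - y) - ((p - \<rho> p) - z)" by (simp add: y(1))
      moreover have "(h - y) - ((p - \<rho> p) - z) \<in> H"
        using H(2) \<rho> y(2,3) B X(1) by (meson subsetD)
      ultimately have "\<rho> h = \<rho> p" using cong[of h p] by metis
      moreover have "h - \<rho> h - z \<in> B" using y(3) \<open>\<rho> h = \<rho> p\<close> by (simp add: y(1) diff_diff_eq)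
      ultimately show "y = \<rho> h + x" using x(3)[OF y(2)] by (simp add: y(1))
    qed
  qed
qed

subsection \<open>Dense tiles in an invariant ideal\<close>

text \<open>Two halves of the same element differ by an element of order at most two, and only
  countably many of those exist.\<close>

lemma in_class_P_halves:
  assumes "in_class_P TYPE('a::{polish_space, topological_ab_group_add})"
  shows "countable {x::'a. x + x = y}"
proof (cases "{x::'a. x + x = y} = {}")
  case False
  then obtain z where z: "z + z = y" by blast
  have "x \<in> (+) z ` {t::'a. \<exists>n::nat. n > 0 \<and> (\<Sum>i<n. t) = 0}" if "x + x = y" for x
  proof
    have "(\<Sum>i<2::nat. x - z) = 0"
      using that z by (simp add: numeral_2_eq_2 algebra_simps)
    then show "x - z \<in> {t. \<exists>n::nat. n > 0 \<and> (\<Sum>i<n. t) = 0}"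
      by (intro CollectI exI[of _ 2]) simp
  qed simp
  then have "{x::'a. x + x = y} \<subseteq> (+) z ` {t::'a. \<exists>n::nat. n > 0 \<and> (\<Sum>i<n. t) = 0}" by blast
  then show ?thesis
    using assms countable_subset by (force simp: in_class_P_def)
qed (metis countable_empty)

lemma lepoll_iff_card_of_ordLeq: "A \<lesssim> B \<longleftrightarrow> |A| \<le>o |B|"
  by (simp add: lepoll_def card_of_ordLeq)

text \<open>Without isolated points the whole space is perfect, and a nonempty perfect set in a
  completely metrizable space has at least continuum many points.\<close>

lemma in_class_P_continuum_le:
  assumes "in_class_P TYPE('a::{polish_space, topological_ab_group_add})"
  shows "|UNIV :: nat set set| \<le>o |UNIV :: 'a set|"
proof -
  have "\<not> open {x::'a}" for x
  proof
    assume "open {x}"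
    then have "x isolated_in UNIV" by (auto simp: isolated_in_def)
    then show False using assms by (simp add: in_class_P_def)
  qed
  then have "euclidean derived_set_of (topspace euclidean) = (UNIV :: 'a set)"
    by (subst derived_set_of_topspace) simp
  then have "(UNIV :: real set) \<lesssim> (UNIV :: 'a set)"
    by (intro lepoll_perfect_set[of euclidean]) (auto simp: completely_metrizable_space_euclidean)
  then have "(UNIV :: nat set set) \<lesssim> (UNIV :: 'a set)"
    using nat_sets_eqpoll_reals by (meson eqpoll_imp_lepoll lepoll_trans)
  then show ?thesis by (simp add: lepoll_iff_card_of_ordLeq)
qed

text \<open>In characteristic three \<open>a + a\<close> equals \<open>- a\<close>, so doubling is
  injective.\<close>

lemma is_K_power_aleph0_halves:
  assumes "is_K_power_aleph0 TYPE('a::{topological_space, ab_group_add})"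
  shows "countable {x::'a. x + x = y}"
proof -
  obtain f :: "'a \<Rightarrow> nat \<Rightarrow> 3" where
    f: "homeomorphic_map euclidean (product_topology (\<lambda>_. discrete_topology UNIV) UNIV) f"
      "\<And>x y. f (x + y) = (\<lambda>n. f x n + f y n)"
    using assms unfolding is_K_power_aleph0_def by auto
  have inj: "inj f" using homeomorphic_imp_injective_map[OF f(1)] by simp
  have three: "a + (a + a) = 0" for a :: 3
  proof -
    have "a + (a + a) = (1 + (1 + 1)) * a" by (simp only: distrib_right mult_1_left)
    also have "1 + (1 + 1) = (0 :: 3)" by simp
    finally show ?thesis by simp
  qed
  have cancel: "a = b" if "a + a = b + b" for a b :: 3
    using three[of a] three[of b] that by (metis add_right_cancel)
  have "x = z" if "x + x = y" "z + z = y" for x z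
  proof -
    have "f x n = f z n" for n
      using f(2)[of x x] f(2)[of z z] that cancel by metis
    then show ?thesis using inj by (meson ext injD)
  qed
  then have uniq: "x = z" if "x + x = y" "z + z = y" for x z using that by blast
  show ?thesis
  proof (cases "\<exists>z. z + z = y")
    case True
    then obtain z where "z + z = y" by blast
    then have "{x. x + x = y} \<subseteq> {z}" using uniq by blast
    then show ?thesis by (rule countable_subset) simp
  qed simp
qed

lemma is_K_power_aleph0_continuum_le:
  assumes "is_K_power_aleph0 TYPE('a::{topological_space, ab_group_add})"
  shows "|UNIV :: nat set set| \<le>o |UNIV :: 'a set|"
proof -
  obtain f :: "'a \<Rightarrow> nat \<Rightarrow> 3" where
    f: "homeomorphic_map euclidean (product_topology (\<lambda>_. discrete_topology UNIV) UNIV) f"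
    using assms unfolding is_K_power_aleph0_def by auto
  have surj: "surj f" using homeomorphic_imp_surjective_map[OF f] by (simp add: PiE_UNIV_domain)
  define e where "e = (\<lambda>A (n::nat). if n \<in> A then 1 else (0::3))"
  have mem: "n \<in> A \<longleftrightarrow> e A n = 1" for n A by (simp add: e_def)
  have "A = A'" if "inv f (e A) = inv f (e A')" for A A'
  proof -
    have "e A = e A'" using that surj_f_inv_f[OF surj] by metis
    then show ?thesis using mem by (intro set_eqI) simp
  qed
  then have "inj (\<lambda>A. inv f (e A))" by (rule injI)
  then show ?thesis using card_of_ordLeq by (metis subset_UNIV)
qed

section \<open>Cardinal bounds, bases and sigma-ideals\<close>

lemma card_of_second_countable_t2:
  "|UNIV :: 'a::{second_countable_topology, t2_space} set| \<le>o |UNIV :: nat set set|"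
proof -
  obtain \<B> :: "'a set set" where B: "countable \<B>" "topological_basis \<B>"
    using ex_countable_basis by blast
  have "inj (\<lambda>x::'a. {n. x \<in> from_nat_into \<B> n})"
  proof (rule injI, rule ccontr)
    fix x y :: 'a assume eq: "{n. x \<in> from_nat_into \<B> n} = {n. y \<in> from_nat_into \<B> n}" and "x \<noteq> y"
    then obtain U where U: "open U" "x \<in> U" "y \<notin> U" by (meson disjoint_iff hausdorff)
    then obtain V where V: "V \<in> \<B>" "x \<in> V" "V \<subseteq> U" using B(2) by (metis topological_basisE)
    then obtain n where "V = from_nat_into \<B> n" using B(1) by (metis from_nat_into_surj)
    then show False using eq U V by auto
  qed
  then show ?thesis using card_of_ordLeq by (metis subset_UNIV)
qed

lemma card_of_seq_le_continuum:
  assumes "|UNIV :: 'b set| \<le>o |UNIV :: nat set set|"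
  shows "|UNIV :: (nat \<Rightarrow> 'b) set| \<le>o |UNIV :: nat set set|"
proof -
  obtain e :: "'b \<Rightarrow> nat set" where e: "inj e" using assms card_of_ordLeq by metis
  define h where "h = (\<lambda>F :: nat \<Rightarrow> 'b. {prod_encode (n, m) |n m. m \<in> e (F n)})"
  have "inj h"
  proof (rule injI)
    fix F G assume eq: "h F = h G"
    have "m \<in> e (F n) \<longleftrightarrow> prod_encode (n, m) \<in> h F" for F n m by (auto simp: h_def)
    then have "e (F n) = e (G n)" for n using eq by blast
    then show "F = G" using e by (meson ext injD)
  qed
  then show ?thesis using card_of_ordLeq by (metis subset_UNIV)
qed

text \<open>Translates of \<open>U\<close> by a countable dense set cover the group, since for each
  \<open>p\<close> the open set of all \<open>d\<close> with \<open>p - d \<in> U\<close> meets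
  it.\<close>

lemma uncountable_open_group:
  fixes U :: "'a::{second_countable_topology, t2_space, topological_ab_group_add} set"
  assumes unc: "uncountable (UNIV :: 'a set)" and U: "open U" "U \<noteq> {}"
  shows "uncountable U"
proof
  assume cU: "countable U"
  obtain D :: "'a set" where D: "countable D" "\<And>X. open X \<Longrightarrow> X \<noteq> {} \<Longrightarrow> \<exists>d\<in>D. d \<in> X"
    using countable_dense_exists by metis
  obtain u where u: "u \<in> U" using U by blast
  have "p \<in> (\<lambda>(d, x). d + x) ` (D \<times> U)" for p
  proof -
    have "open ((\<lambda>d. p - d) -` U)"
      by (intro open_vimage U continuous_intros)
    moreover have "p - u \<in> (\<lambda>d. p - d) -` U" using u by simp
    ultimately obtain d where "d \<in> D" "p - d \<in> U" using D(2) by blast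
    then show ?thesis by (intro image_eqI[of _ _ "(d, p - d)"]) auto
  qed
  then have "UNIV \<subseteq> (\<lambda>(d, x). d + x) ` (D \<times> U)" by blast
  then show False using unc D(1) cU countable_subset by blast
qed

lemma countable_pi_base_exists:
  obtains U :: "nat \<Rightarrow> 'a::second_countable_topology set"
  where "\<And>n. open (U n)" "\<And>n. U n \<noteq> {}" "\<And>V. open V \<Longrightarrow> V \<noteq> {} \<Longrightarrow> \<exists>n. U n \<subseteq> V"
proof -
  obtain \<B> :: "'a set set" where B: "countable \<B>" "topological_basis \<B>"
    using ex_countable_basis by blast
  define \<C> where "\<C> = \<B> - {{}}"
  have sub: "\<exists>W\<in>\<C>. W \<subseteq> V" if V: "open V" "V \<noteq> {}" for V
  proof -
    obtain x where "x \<in> V" using V by blast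
    then obtain W where "W \<in> \<B>" "x \<in> W" "W \<subseteq> V" using B(2) V(1) by (metis topological_basisE)
    then show ?thesis by (auto simp: \<C>_def)
  qed
  have ne: "\<C> \<noteq> {}" using sub[of UNIV] by auto
  have c: "countable \<C>" using B(1) by (simp add: \<C>_def)
  show ?thesis
  proof (rule that[of "from_nat_into \<C>"])
    have "from_nat_into \<C> n \<in> \<C>" for n using ne by (rule from_nat_into)
    then show "open (from_nat_into \<C> n)" "from_nat_into \<C> n \<noteq> {}" for n
      using B(2) topological_basis_open by (auto simp: \<C>_def)
    show "\<exists>n. from_nat_into \<C> n \<subseteq> V" if "open V" "V \<noteq> {}" for V
      using sub[OF that] c by (metis from_nat_into_surj)
  qed
qed

lemma sigma_ideal_subset: "sigma_ideal \<L> \<Longrightarrow> A \<in> \<L> \<Longrightarrow> B \<subseteq> A \<Longrightarrow> B \<in> \<L>"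
  by (auto simp: sigma_ideal_def)

lemma sigma_ideal_UN: "sigma_ideal \<L> \<Longrightarrow> countable I \<Longrightarrow> (\<And>i. i \<in> I \<Longrightarrow> A i \<in> \<L>) \<Longrightarrow> (\<Union>i\<in>I. A i) \<in> \<L>"
  unfolding sigma_ideal_def by (metis (mono_tags, lifting) countable_image image_subsetI)

lemma sigma_ideal_Un:
  assumes "sigma_ideal \<L>" "A \<in> \<L>" "B \<in> \<L>"
  shows "A \<union> B \<in> \<L>"
proof -
  have "(\<Union>i\<in>(UNIV::bool set). if i then A else B) \<in> \<L>"
    using assms by (intro sigma_ideal_UN) auto
  then show ?thesis by (simp add: UNIV_bool Un_commute)
qed

text \<open>A point of \<open>L\<close> can be translated to any other place, which supplies the
  singletons that the ideal is not assumed to contain.\<close>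

lemma sigma_ideal_countable:
  fixes \<L> :: "'a::ab_group_add set set"
  assumes "sigma_ideal \<L>" "translation_invariant \<L>" "L \<in> \<L>" "L \<noteq> {}" "countable A"
  shows "A \<in> \<L>"
proof -
  have "{x} \<in> \<L>" for x
  proof -
    obtain l where "l \<in> L" using assms by blast
    then have "{l} \<in> \<L>" using assms(1,3) sigma_ideal_subset by blast
    from assms(2)[unfolded translation_invariant_def, rule_format, OF this, of "x - l"]
    show ?thesis by simp
  qed
  then have "(\<Union>x\<in>A. {x}) \<in> \<L>" using assms by (intro sigma_ideal_UN) auto
  then show ?thesis by simp
qed

lemma ordIso_natLeq_of_not_ordLess:
  fixes \<kappa> :: "'k rel"
  assumes "Card_order \<kappa>" "natLeq \<le>o \<kappa>" "\<not> natLeq <o \<kappa>"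
  shows "\<kappa> =o natLeq"
  using assms ordLeq_iff_ordLess_or_ordIso ordIso_symmetric by blast

text \<open>For \<open>\<kappa> = \<aleph>\<^sub>0\<close> the sets granted by the ideal are countable and cannot be hit outside
  a countable closure; there every countable set lies in the ideal, and the basic open sets
  themselves serve as the sets to choose from.\<close>
lemma card_dense_tile_exists:
  fixes \<kappa> :: "'k rel" and \<L> :: "'a::{polish_space, topological_ab_group_add} set set"
  assumes half: "\<And>y::'a. countable {x. x + x = y}"
    and c: "|UNIV :: nat set set| \<le>o |UNIV :: 'a set|"
    and \<kappa>: "Card_order \<kappa>" "natLeq \<le>o \<kappa>"
    and \<L>: "sigma_ideal \<L>" "translation_invariant \<L>"
      "\<And>U :: 'a set. open U \<Longrightarrow> U \<noteq> {} \<Longrightarrow> \<exists>L\<in>\<L>. L \<subseteq> U \<and> |L| =o \<kappa>"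
  obtains B0 B1 X where "B0 \<union> B1 \<in> \<L>" "B0 \<inter> B1 = {}" "card_dense \<kappa> B0" "card_dense \<kappa> B1"
    "|B0 \<union> B1| =o \<kappa>" "|X| =o |UNIV :: nat set set|" "\<And>h::'a. \<exists>!x. x \<in> X \<and> h - x \<in> B0 \<union> B1"
proof -
  obtain U :: "nat \<Rightarrow> 'a set" where U: "\<And>n. open (U n)" "\<And>n. U n \<noteq> {}"
    "\<And>V. open V \<Longrightarrow> V \<noteq> {} \<Longrightarrow> \<exists>n. U n \<subseteq> V"
    using countable_pi_base_exists by metis
  have "\<exists>L. \<forall>n. L n \<in> \<L> \<and> L n \<subseteq> U n \<and> |L n| =o \<kappa>"
    using \<L>(3)[OF U(1,2)] by (intro choice) blast
  then obtain L where L: "\<And>n. L n \<in> \<L>" "\<And>n. L n \<subseteq> U n" "\<And>n. |L n| =o \<kappa>" by blast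
  have inf: "infinite (Field \<kappa>)"
    using \<kappa> cinfinite_mono natLeq_cinfinite unfolding cinfinite_def by blast
  have cinf: "Cinfinite \<kappa>" using inf \<kappa> by (simp add: cinfinite_def)
  have F\<kappa>: "|Field \<kappa>| =o \<kappa>" using \<kappa>(1) by (rule card_of_Field_ordIso)
  have "uncountable (UNIV :: nat set set)"
    using nat_sets_eqpoll_reals uncountable_UNIV_real countable_eqpoll eqpoll_sym by blast
  then have uncU: "uncountable (U n)" for n
    using c U uncountable_open_group countable_ordLeq ordLeq_transitive by metis
  \<comment> \<open>The index set provides \<kappa> points for each basic open set and each of two
    colours. The colours produce two disjoint \<kappa>-dense halves, so that in (ii) one half of a
    tile can be given away while the other keeps it \<kappa>-dense.\<close>
  define J where "J = Field \<kappa> \<times> (UNIV::nat set) \<times> (UNIV :: bool set)"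
  have J: "|J| =o \<kappa>"
  proof -
    have "|J| =o |Field \<kappa>|" unfolding J_def
      using inf by (intro card_of_Times_infinite_simps(1)) (auto intro: countable_ordLeq_infinite)
    then show ?thesis using F\<kappa> ordIso_transitive by blast
  qed
  define W where "W = (\<lambda>(k::'k, n, b::bool). if natLeq <o \<kappa> then L n else U n)"
  have JW: "|J| \<le>o |W j|" and uW: "uncountable (W j)" for j
  proof -
    obtain k n b where j: "j = (k, n, b)" by (cases j)
    show "|J| \<le>o |W j|"
    proof (cases "natLeq <o \<kappa>")
      case True
      then show ?thesis using J L(3) ordIso_symmetric ordIso_transitive ordIso_iff_ordLeq
        by (simp add: j W_def) blast
    next
      case False
      then have "\<kappa> =o natLeq" using \<kappa> ordIso_natLeq_of_not_ordLess by blast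
      then have "|J| =o natLeq" using J ordIso_transitive by blast
      then have "countable J" using countable_ordLeq card_of_nat ordIso_iff_ordLeq ordIso_symmetric ordIso_transitive by metis
      then show ?thesis using False countable_ordLeq_infinite[OF _ uncountable_infinite[OF uncU[of n]]]
        by (simp add: j W_def)
    qed
    show "uncountable (W j)"
    proof (cases "natLeq <o \<kappa>")
      case True
      then have "natLeq <o |L n|" using L(3) ordIso_symmetric ordLess_ordIso_trans by blast
      then have "\<not> |L n| \<le>o |UNIV :: nat set|"
        using card_of_nat not_ordLess_ordLeq ordLeq_ordIso_trans by blast
      then have "uncountable (L n)" using countable_ordLeq by metis
      then show ?thesis using True by (simp add: j W_def)
    next
      case False
      then show ?thesis using uncU by (simp add: j W_def)
    qed
  qed
  obtain f where f: "inj_on f J" "\<And>j. j \<in> J \<Longrightarrow> f j \<in> W j" "dissociated (f ` J)"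
    using dissociated_family_exists[OF half, of J W] JW uW by metis
  have WU: "W (k, n, b) \<subseteq> U n" for k n b using L(2) by (simp add: W_def)
  define B where "B = f ` J"
  define Bb where "Bb = (\<lambda>b. f ` (Field \<kappa> \<times> UNIV \<times> {b}))"
  have "J = (Field \<kappa> \<times> UNIV \<times> {False}) \<union> (Field \<kappa> \<times> UNIV \<times> {True})"
    unfolding J_def UNIV_bool by blast
  then have Bsplit: "B = Bb False \<union> Bb True" by (simp only: B_def Bb_def image_Un)
  have disj: "Bb False \<inter> Bb True = {}"
  proof -
    have "(Field \<kappa> \<times> UNIV \<times> {False}) \<inter> (Field \<kappa> \<times> UNIV \<times> {True}) = {}"
      "(Field \<kappa> \<times> UNIV \<times> {False}) \<subseteq> J" "(Field \<kappa> \<times> UNIV \<times> {True}) \<subseteq> J" by (auto simp: J_def)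
    then show ?thesis unfolding Bb_def using inj_on_image_Int[OF f(1)] by (metis image_empty)
  qed
  have cB: "|B| =o \<kappa>"
    unfolding B_def using f(1) J card_of_ordIso ordIso_symmetric ordIso_transitive bij_betw_imageI by metis
  have infB: "infinite B" using cB inf F\<kappa> card_of_ordIso_finite ordIso_symmetric ordIso_transitive by metis
  have dense: "card_dense \<kappa> (Bb b)" for b
    unfolding card_dense_def
  proof (intro allI impI)
    fix V :: "'a set" assume "open V \<and> V \<noteq> {}"
    then obtain n where n: "U n \<subseteq> V" using U(3) by blast
    have sub: "f ` (Field \<kappa> \<times> {n} \<times> {b}) \<subseteq> Bb b \<inter> V"
    proof
      fix x assume "x \<in> f ` (Field \<kappa> \<times> {n} \<times> {b})"
      then obtain k where k: "k \<in> Field \<kappa>" "x = f (k, n, b)" by auto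
      then have "x \<in> W (k, n, b)" using f(2) by (simp add: J_def)
      then have "f (k, n, b) \<in> V" using WU n k by blast
      then show "x \<in> Bb b \<inter> V" using k by (auto simp: Bb_def)
    qed
    have "inj_on (\<lambda>k. f (k, n, b)) (Field \<kappa>)"
      using f(1) by (auto simp: inj_on_def J_def)
    moreover have "(\<lambda>k. f (k, n, b)) ` Field \<kappa> \<subseteq> Bb b \<inter> V" using sub by auto
    ultimately have "|Field \<kappa>| \<le>o |Bb b \<inter> V|" using card_of_ordLeq by blast
    moreover have "|Bb b \<inter> V| \<le>o |B|" unfolding Bsplit by (rule card_of_mono1) (cases b; auto)
    ultimately show "|Bb b \<inter> V| =o \<kappa>"
      using cB F\<kappa> by (meson ordIso_iff_ordLeq ordLeq_transitive)
  qed
  have BL: "B \<in> \<L>"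
  proof (cases "natLeq <o \<kappa>")
    case True
    have "B \<subseteq> (\<Union>n. L n)" using f(2) True by (force simp: B_def J_def W_def)
    moreover have "(\<Union>n. L n) \<in> \<L>" using L(1) by (intro sigma_ideal_UN \<L>) auto
    ultimately show ?thesis using sigma_ideal_subset \<L>(1) by blast
  next
    case False
    then have "|B| =o natLeq" using \<kappa> cB ordIso_natLeq_of_not_ordLess ordIso_transitive by blast
    then have "countable B" using countable_ordLeq card_of_nat ordIso_iff_ordLeq ordIso_symmetric ordIso_transitive by metis
    moreover have "L 0 \<noteq> {}"
      using L(3)[of 0] inf F\<kappa> card_of_ordIso_finite ordIso_symmetric ordIso_transitive finite.emptyI by metis
    ultimately show ?thesis using sigma_ideal_countable[OF \<L>(1,2) L(1)] by blast
  qed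
  \<comment> \<open>The tiling is first carried out in a subgroup of the same size as
    \<open>B\<close>, where every stage of the recursion has fewer than \<open>|B|\<close>
    predecessors.\<close>
  obtain H where H: "B \<subseteq> H" "halving_closed H" "|H| \<le>o |B|"
    using halving_closure_exists[OF half infB, of B] card_of_refl ordIso_iff_ordLeq by blast
  note Hc = halving_closedD[OF H(2)]
  have cH: "|H| =o |B|" using H card_of_mono1 ordIso_iff_ordLeq by blast
  have dis: "dissociated B" using f(3) by (simp add: B_def)
  obtain X0 where X0: "X0 \<subseteq> H" "\<And>h. h \<in> H \<Longrightarrow> \<exists>!x. x \<in> X0 \<and> h - x \<in> B"
    using tile_subgroup[OF infB H(1) cH Hc(1) dissociated_finite_representations[OF dis]] by blast
  obtain X where X: "\<And>h. \<exists>!x. x \<in> X \<and> h - x \<in> B"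
    using tile_group[OF Hc(5) Hc(1) H(1) X0] by blast
  \<comment> \<open>If \<open>- b\<close> lies in the tile at \<open>x\<close>, then
    \<open>- x\<close> is the sum of \<open>b\<close> and another element of \<open>B\<close>, so
    \<open>x\<close> accounts for finitely many \<open>b\<close>. This excludes a small number of
    tiles even when \<open>B\<close> is as large as the group.\<close>
  have BX: "|B| \<le>o |X|"
  proof (rule ccontr)
    assume "\<not> |B| \<le>o |X|"
    then have lt: "|X| <o |B|" by (meson card_of_Well_order not_ordLeq_iff_ordLess)
    have "B \<subseteq> (\<Union>x\<in>X. {b \<in> B. \<exists>b2\<in>B. - x = b + b2})"
    proof
      fix b assume b: "b \<in> B"
      obtain x where x: "x \<in> X" "- b - x \<in> B" using X[of "- b"] by blast
      have "- x = b + (- b - x)" by simp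
      then show "b \<in> (\<Union>x\<in>X. {b \<in> B. \<exists>b2\<in>B. - x = b + b2})" using x b by blast
    qed
    then have "|B| \<le>o |\<Union>x\<in>X. {b \<in> B. \<exists>b2\<in>B. - x = b + b2}|" by (rule card_of_mono1)
    moreover have "|\<Union>x\<in>X. {b \<in> B. \<exists>b2\<in>B. - x = b + b2}| <o |B|"
      using lt infB dissociated_finite_sums[OF dis] by (intro card_of_UN_finite_ordLess) auto
    ultimately show False using not_ordLess_ordLeq by blast
  qed
  have infX: "infinite X" using BX infB card_of_ordLeq_finite by blast
  have "|UNIV :: 'a set| \<le>o |X|"
  proof -
    have "p \<in> (\<Union>x\<in>X. (+) x ` B)" for p
    proof -
      obtain x where "x \<in> X" "p - x \<in> B" using X[of p] by blast
      then show ?thesis by (intro UN_I[of x] image_eqI[of _ _ "p - x"]) auto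
    qed
    then have "UNIV = (\<Union>x\<in>X. (+) x ` B)" by blast
    moreover have "|\<Union>x\<in>X. (+) x ` B| \<le>o |X|"
      using infX BX card_of_image[of "(+) _" B] 
      by (intro UNION_Cinfinite_bound Cinfinite_card_of)
        (auto intro: ordLeq_transitive card_of_refl ordIso_imp_ordLeq)
    ultimately show ?thesis by simp
  qed
  moreover have "|X| \<le>o |UNIV :: nat set set|"
    using card_of_second_countable_t2 card_of_mono1[of X UNIV] ordLeq_transitive by blast
  ultimately have "|X| =o |UNIV :: nat set set|"
    using c ordIso_iff_ordLeq ordLeq_transitive by blast
  then show ?thesis using that[of "Bb False" "Bb True" X] BL disj dense cB X unfolding Bsplit by blast
qed

subsection \<open>Exchanging parts of tiles\<close>

lemma card_of_homeomorphic_copies: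
  fixes S :: "'a::{second_countable_topology, metric_space} set"
  shows "|{T::'a set. S homeomorphic T}| \<le>o |UNIV :: (nat \<Rightarrow> 'a) set|"
proof (cases "S = {}")
  case True
  then have "{T::'a set. S homeomorphic T} = {{}}" by auto
  then show ?thesis using card_of_singl_ordLeq[of "UNIV :: (nat \<Rightarrow> 'a) set"] by simp
next
  case False
  obtain D where D: "countable D" "D \<subseteq> S" "S \<subseteq> closure D" using separable by blast
  then have "D \<noteq> {}" using False by auto
  define h where "h = (\<lambda>T::'a set. SOME f. \<exists>g. homeomorphism S T f g)"
  have h: "\<exists>g. homeomorphism S T (h T) g" if "S homeomorphic T" for T :: "'a set"
    using that unfolding h_def homeomorphic_def by (rule someI_ex)
  \<comment> \<open>A copy \<open>T\<close> is encoded by the values of one chosen homeomorphism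
    along an enumeration of \<open>D\<close>; they determine the map on \<open>S\<close> and hence
    its image \<open>T\<close>.\<close>
  define e where "e = (\<lambda>T n. h T (from_nat_into D n))"
  have "inj_on e {T. S homeomorphic T}"
  proof (rule inj_onI)
    fix T T' assume T: "T \<in> {T. S homeomorphic T}" "T' \<in> {T. S homeomorphic T}" and eq: "e T = e T'"
    obtain g g' where g: "homeomorphism S T (h T) g" "homeomorphism S T' (h T') g'" using h T by blast
    have on_D: "h T x = h T' x" if x: "x \<in> D" for x
    proof -
      obtain n where "x = from_nat_into D n" using from_nat_into_surj[OF D(1) x] by metis
      then show ?thesis using fun_cong[OF eq, of n] by (simp add: e_def)
    qed
    have "h T x = h T' x" if x: "x \<in> S" for x
    proof (rule forall_in_closure_of_eq[of x "top_of_set S" D euclidean])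
      show "x \<in> top_of_set S closure_of D"
        using x D by (auto simp: closure_of_subtopology Int_absorb1)
      show "continuous_map (top_of_set S) euclidean (h T)" "continuous_map (top_of_set S) euclidean (h T')"
        using g by (auto simp: homeomorphism_def)
    qed (use on_D in auto)
    then have "h T ` S = h T' ` S" by (rule image_cong[OF refl])
    then show "T = T'" using g by (simp add: homeomorphism_def)
  qed
  then show ?thesis using card_of_ordLeq by (metis subset_UNIV)
qed

text \<open>The tiles are arranged in sequences, and every tile hands a part over to its predecessor.
  A sequence has no last tile, so the type of every set can still be controlled when it is formed.\<close>
lemma exchange_partition:
  fixes T M :: "'i \<times> nat \<Rightarrow> 'a set"
  assumes T: "\<And>x. \<exists>!i. x \<in> T i" and M: "\<And>i. M i \<subseteq> T i"
    and many: "\<And>A j. \<not> |Pow (M j)| \<le>o |\<Union>i::'i \<times> nat. {C. E (A i) C}|"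
    and sym: "\<And>A C. E A C \<Longrightarrow> E C A"
  obtains S where "\<And>i. T i - M i \<subseteq> S i" "\<And>i. \<exists>j. S i \<subseteq> T i \<union> T j" "\<And>x. \<exists>!i. x \<in> S i"
    "\<And>i j. i \<noteq> j \<Longrightarrow> \<not> E (S i) (S j)"
proof -
  obtain Q where Q: "wf Q" "trans Q" "\<And>x y :: 'i. x \<noteq> y \<Longrightarrow> (x, y) \<in> Q \<or> (y, x) \<in> Q"
    using strict_card_order[of "UNIV :: 'i set"] by auto
  \<comment> \<open>The lexicographic order puts each tile after its predecessor in the same
    sequence, so what it has lost is known when its own set is formed.\<close>
  define R where "R = Q <*lex*> less_than"
  have wfR: "wf R" unfolding R_def by (intro wf_lex_prod Q wf_less_than)
  have trR: "trans R" unfolding R_def by (intro trans_lex_prod Q trans_less_than)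
  have totR: "(i, j) \<in> R \<or> (j, i) \<in> R" if "i \<noteq> j" for i j
    using that Q(3) by (cases i; cases j) (auto simp: R_def)
  \<comment> \<open>Tile \<open>i\<close> receives \<open>f i\<close> from the next tile
    \<open>s i\<close> and has lost \<open>pre f i\<close> to the previous one; the first tile of a
    sequence loses nothing.\<close>
  define s where "s = (\<lambda>i :: 'i \<times> nat. (fst i, Suc (snd i)))"
  define pre where "pre = (\<lambda>(f :: 'i \<times> nat \<Rightarrow> 'a set) i. case snd i of 0 \<Rightarrow> {} | Suc n \<Rightarrow> f (fst i, n))"
  define S where "S = (\<lambda>f i. (T i - pre f i) \<union> f i)"
  have pre_s: "pre f (s i) = f i" for f i by (simp add: pre_def s_def)
  have pre_cong: "pre f i = pre g i" if "\<And>z. (z, i) \<in> R \<Longrightarrow> f z = g z" for f g i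
    using that by (cases i) (auto simp: pre_def R_def split: nat.split)
  define P where "P = (\<lambda>f i A. A \<subseteq> M (s i) \<and> (\<forall>j. (j, i) \<in> R \<longrightarrow> \<not> E (S f j) ((T i - pre f i) \<union> A)))"
  have "\<exists>f. \<forall>i. P f i (f i)"
  proof (rule dependent_wf_choice[OF wfR])
    fix f g i A assume eq: "\<And>z. (z, i) \<in> R \<Longrightarrow> f z = (g z :: 'a set)"
    have "S f j = S g j" if "(j, i) \<in> R" for j
    proof -
      have "pre f j = pre g j" using eq that trR by (intro pre_cong) (meson transD)
      then show ?thesis using eq[OF that] by (simp add: S_def)
    qed
    moreover have "pre f i = pre g i" using eq by (rule pre_cong)
    ultimately show "P f i A = P g i A" by (auto simp: P_def)
  next
    fix i and f :: "'i \<times> nat \<Rightarrow> 'a set"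
    show "\<exists>A. P f i A"
    proof (rule ccontr)
      assume "\<nexists>A. P f i A"
      \<comment> \<open>If every \<open>A\<close> failed, sending \<open>A\<close> to the set formed
        from it would inject \<open>Pow (M (s i))\<close> into the union of the
        \<open>E\<close>-classes of all sets \<open>S f j\<close>. Injectivity holds because
        \<open>T i\<close> is disjoint from \<open>M (s i)\<close>.\<close>
      then have bad: "\<exists>j. E (S f j) ((T i - pre f i) \<union> A)" if "A \<subseteq> M (s i)" for A
        using that unfolding P_def by blast
      define h where "h = (\<lambda>A. (T i - pre f i) \<union> A)"
      have "s i \<noteq> i" by (cases i) (simp add: s_def)
      then have "T i \<inter> M (s i) = {}" using T M by blast
      then have "inj_on h (Pow (M (s i)))" unfolding h_def by (intro inj_onI) blast
      moreover have "h ` Pow (M (s i)) \<subseteq> (\<Union>j. {C. E (S f j) C})" using bad by (auto simp: h_def)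
      ultimately have "|Pow (M (s i))| \<le>o |\<Union>j. {C. E (S f j) C}|" using card_of_ordLeq by blast
      then show False using many by blast
    qed
  qed
  then obtain f where f: "\<And>i. P f i (f i)" by blast
  have fM: "f i \<subseteq> M (s i)" for i using f[of i] by (simp add: P_def)
  have pre_sub: "pre f i \<subseteq> M i" for i
  proof (cases i)
    case (Pair a n)
    then show ?thesis using fM[of "(a, n - 1)"] by (cases n) (auto simp: pre_def s_def)
  qed
  show ?thesis
  proof (rule that[of "S f"])
    show "T i - M i \<subseteq> S f i" for i using pre_sub[of i] by (auto simp: S_def)
    show "\<exists>j. S f i \<subseteq> T i \<union> T j" for i using fM[of i] M[of "s i"] by (intro exI[of _ "s i"]) (auto simp: S_def)
    show "\<exists>!i. x \<in> S f i" for x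
    proof -
      obtain i where i: "x \<in> T i" "\<And>j. x \<in> T j \<Longrightarrow> j = i" using T[of x] by blast
      \<comment> \<open>A point of tile \<open>i\<close> either stays or passes to the predecessor
        of \<open>i\<close>, never both.\<close>
      have mem: "x \<in> S f j \<longleftrightarrow> (if x \<in> pre f i then s j = i else j = i)" for j
      proof -
        have "x \<in> T j \<longleftrightarrow> j = i" using i by blast
        then have "x \<in> S f j \<longleftrightarrow> (j = i \<and> x \<notin> pre f i) \<or> x \<in> f j"
          by (cases "j = i") (simp_all add: S_def)
        moreover have "x \<in> f j \<longleftrightarrow> s j = i \<and> x \<in> pre f i"
        proof
          assume "x \<in> f j"
          moreover then have "s j = i" using fM M i(2) by blast
          ultimately show "s j = i \<and> x \<in> pre f i" using pre_s[of f j] by simp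
        next
          assume "s j = i \<and> x \<in> pre f i"
          then show "x \<in> f j" using pre_s[of f j] by simp
        qed
        ultimately show ?thesis by (cases "x \<in> pre f i") simp_all
      qed
      show ?thesis
      proof (cases "x \<in> pre f i")
        case True
        then obtain n where "snd i = Suc n" by (auto simp: pre_def split: nat.splits)
        then have "s j = i \<longleftrightarrow> j = (fst i, n)" for j by (cases i; cases j) (auto simp: s_def)
        then show ?thesis using mem True by simp
      qed (use mem in simp)
    qed
    show "\<not> E (S f i) (S f j)" if "i \<noteq> j" for i j
    proof -
      have "\<not> E (S f a) (S f b)" if "(a, b) \<in> R" for a b
        using f[of b] that unfolding P_def S_def by blast
      then show ?thesis using totR[OF that] sym by blast
    qed
  qed
qed

section \<open>Partitions from indexed families and translates\<close>

lemma partition_on_range: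
  assumes "\<And>x. \<exists>!i::'i. x \<in> S i" "\<And>i. S i \<noteq> {}"
  shows "partition_on UNIV (range S)" "|range S| =o |UNIV :: 'i set|"
proof -
  show "partition_on UNIV (range S)"
  proof (rule partition_onI)
    show "\<Union> (range S) = UNIV" using assms(1) by blast
  next
    fix p q assume "p \<in> range S" "q \<in> range S" "p \<noteq> q"
    then obtain i j where "p = S i" "q = S j" "i \<noteq> j" by blast
    then show "disjnt p q" using assms(1) unfolding disjnt_def by blast
  next
    show "{} \<notin> range S" using assms(2) by auto
  qed
  have "inj S"
  proof (rule injI)
    fix i j assume "S i = S j"
    moreover obtain x where "x \<in> S i" using assms(2) by blast
    ultimately have "x \<in> S i" "x \<in> S j" by simp_all
    then show "i = j" using assms(1) by blast
  qed
  then have "|UNIV :: 'i set| =o |range S|" unfolding card_of_ordIso[symmetric] by (auto simp: bij_betw_def)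
  then show "|range S| =o |UNIV :: 'i set|" by (rule ordIso_symmetric)
qed

lemma mem_translate_iff: "h \<in> (+) x ` B \<longleftrightarrow> h - x \<in> B" for x h :: "'a::ab_group_add"
proof
  assume "h - x \<in> B"
  then show "h \<in> (+) x ` B" by (intro image_eqI[of _ _ "h - x"]) auto
qed auto

lemma reindex_translates:
  fixes B X :: "'a::ab_group_add set"
  assumes X: "\<And>h. \<exists>!x. x \<in> X \<and> h - x \<in> B" and card: "|X| =o |UNIV :: 'j set|"
  obtains g :: "'j \<Rightarrow> 'a" where "bij_betw g UNIV X" "\<And>h. \<exists>!j. h \<in> (+) (g j) ` B"
proof -
  obtain g :: "'j \<Rightarrow> 'a" where g: "bij_betw g UNIV X" using card card_of_ordIso ordIso_symmetric by blast
  have "\<exists>!j. h \<in> (+) (g j) ` B" for h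
  proof -
    obtain x where x: "x \<in> X" "h - x \<in> B" "\<And>y. y \<in> X \<Longrightarrow> h - y \<in> B \<Longrightarrow> y = x" using X[of h] by blast
    obtain j where j: "g j = x" using x(1) g by (metis bij_betw_imp_surj_on imageE)
    show ?thesis unfolding mem_translate_iff
    proof (rule ex1I[of _ j])
      fix k assume "h - g k \<in> B"
      then have "g k = g j" using x(3) j g by (metis bij_betwE UNIV_I)
      then show "k = j" using g by (meson UNIV_I bij_betw_imp_inj_on inj_onD)
    qed (simp add: j x)
  qed
  then show ?thesis using that g by blast
qed

lemma open_translate_vimage:
  fixes U :: "'a::topological_ab_group_add set"
  shows "open U \<Longrightarrow> open ((+) x -` U)"
  by (intro open_vimage continuous_intros)

lemma card_dense_translate:
  fixes B :: "'a::topological_ab_group_add set"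
  assumes "card_dense \<kappa> B"
  shows "card_dense \<kappa> ((+) x ` B)"
  unfolding card_dense_def
proof (intro allI impI)
  fix U :: "'a set" assume U: "open U \<and> U \<noteq> {}"
  have "(+) x -` U \<noteq> {}"
  proof -
    obtain u where "u \<in> U" using U by blast
    then have "u - x \<in> (+) x -` U" by simp
    then show ?thesis by blast
  qed
  then have "|B \<inter> (+) x -` U| =o \<kappa>" using assms U open_translate_vimage by (auto simp: card_dense_def)
  moreover have "bij_betw ((+) x) (B \<inter> (+) x -` U) ((+) x ` B \<inter> U)"
    by (auto simp: bij_betw_def)
  ultimately show "|(+) x ` B \<inter> U| =o \<kappa>"
    using card_of_ordIso ordIso_symmetric ordIso_transitive by blast
qed

lemma homeomorphic_translates:
  fixes B :: "'a::topological_ab_group_add set"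
  shows "(+) x ` B homeomorphic (+) y ` B"
  unfolding homeomorphic_def homeomorphism_def
  by (rule exI[of _ "\<lambda>z. z - x + y"], rule exI[of _ "\<lambda>z. z - y + x"])
    (auto simp: image_image algebra_simps intro!: continuous_intros)

lemma card_dense_superset:
  fixes A S :: "'a::topological_space set"
  assumes "card_dense \<kappa> A" "A \<subseteq> S" "|S| \<le>o \<kappa>"
  shows "card_dense \<kappa> S"
  unfolding card_dense_def
proof (intro allI impI)
  fix U :: "'a set" assume "open U \<and> U \<noteq> {}"
  then have "|A \<inter> U| =o \<kappa>" using assms(1) by (simp add: card_dense_def)
  moreover have "|A \<inter> U| \<le>o |S \<inter> U|" "|S \<inter> U| \<le>o |S|" using assms(2) by (auto intro!: card_of_mono1)
  ultimately show "|S \<inter> U| =o \<kappa>" using assms(3)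
    by (meson ordIso_iff_ordLeq ordIso_ordLeq_trans ordIso_symmetric ordLeq_transitive)
qed

lemma card_dense_nonempty:
  fixes S :: "'a::topological_space set"
  assumes "card_dense \<kappa> S" "natLeq \<le>o \<kappa>"
  shows "S \<noteq> {}"
proof
  assume "S = {}"
  then have "|{} :: 'a set| =o \<kappa>" using assms(1) unfolding card_dense_def by (metis Int_empty_left UNIV_not_empty open_UNIV)
  then have "natLeq \<le>o |{} :: 'a set|" using assms(2) ordIso_symmetric ordLeq_ordIso_trans by blast
  then have "|UNIV :: nat set| \<le>o |{} :: 'a set|" using card_of_nat ordIso_ordLeq_trans by blast
  then show False using card_of_ordLeq_infinite[of "UNIV :: nat set"] by auto
qed

lemma card_of_continuum_Times:
  assumes "countable (UNIV :: 'b set)"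
  shows "|UNIV :: (nat set \<times> 'b) set| =o |UNIV :: nat set set|"
proof -
  have inf: "infinite (UNIV :: nat set set)"
    using Finite_Set.finite_set infinite_UNIV_nat by blast
  have "|(UNIV :: nat set set) \<times> (UNIV :: 'b set)| =o |UNIV :: nat set set|"
    using inf assms by (intro card_of_Times_infinite_simps(1)) (auto intro: countable_ordLeq_infinite)
  then show ?thesis by simp
qed

lemma homogeneous_partition:
  fixes \<kappa> :: "'k rel" and \<L> :: "'a::topological_ab_group_add set set"
  assumes "natLeq \<le>o \<kappa>" "translation_invariant \<L>"
    and B: "B \<in> \<L>" "card_dense \<kappa> B"
    and X: "|X| =o |UNIV :: nat set set|" "\<And>h. \<exists>!x. x \<in> X \<and> h - x \<in> B"
  shows "\<exists>\<P> \<subseteq> \<L>. partition_on UNIV \<P> \<and> (\<forall>S\<in>\<P>. card_dense \<kappa> S) \<and> |\<P>| =o continuum \<and>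
    (\<forall>S\<in>\<P>. \<forall>T\<in>\<P>. S homeomorphic T) \<and> (\<exists>L\<in>\<L>. \<exists>X. \<P> = {(+) x ` L |x. x \<in> X})"
proof -
  obtain g :: "nat set \<Rightarrow> 'a" where g: "bij_betw g UNIV X" "\<And>h. \<exists>!j. h \<in> (+) (g j) ` B"
    using reindex_translates[OF X(2,1)] by blast
  let ?S = "\<lambda>j. (+) (g j) ` B"
  have ne: "?S j \<noteq> {}" for j using card_dense_nonempty[OF B(2) assms(1)] by simp
  show ?thesis
  proof (intro exI[of _ "range ?S"] conjI bexI[of _ B])
    show "range ?S \<subseteq> \<L>" using assms(2) B(1) by (auto simp: translation_invariant_def)
    show "partition_on UNIV (range ?S)" by (rule partition_on_range(1)[OF g(2) ne])
    show "|range ?S| =o continuum"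
      using partition_on_range(2)[OF g(2) ne] continuum_ordIso ordIso_symmetric ordIso_transitive by blast
    show "\<forall>S\<in>range ?S. card_dense \<kappa> S" using card_dense_translate[OF B(2)] by blast
    show "\<forall>S\<in>range ?S. \<forall>T\<in>range ?S. S homeomorphic T" using homeomorphic_translates by blast
    show "\<exists>X. range ?S = {(+) x ` B |x. x \<in> X}" by (rule exI[of _ "range g"]) auto
  qed (rule B(1))
qed

lemma nonhomeomorphic_partition:
  fixes \<kappa> :: "'k rel" and \<L> :: "'a::{polish_space, topological_ab_group_add} set set"
  assumes \<kappa>: "Card_order \<kappa>" "natLeq \<le>o \<kappa>"
    and \<L>: "sigma_ideal \<L>" "translation_invariant \<L>"
    and B: "B0 \<union> B1 \<in> \<L>" "B0 \<inter> B1 = {}" "card_dense \<kappa> B0" "card_dense \<kappa> B1" "|B0 \<union> B1| =o \<kappa>"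
    and X: "|X| =o |UNIV :: nat set set|" "\<And>h. \<exists>!x. x \<in> X \<and> h - x \<in> B0 \<union> B1"
    and big: "continuum <o ctwo ^c \<kappa>"
  shows "\<exists>\<P> \<subseteq> \<L>. partition_on UNIV \<P> \<and> (\<forall>S\<in>\<P>. card_dense \<kappa> S) \<and> |\<P>| =o continuum \<and>
    (\<forall>S\<in>\<P>. \<forall>T\<in>\<P>. S \<noteq> T \<longrightarrow> \<not> S homeomorphic T)"
proof -
  have cardI: "|UNIV :: (nat set \<times> nat) set| =o |UNIV :: nat set set|"
    by (rule card_of_continuum_Times) simp
  have infc: "infinite (UNIV :: nat set set)"
    using Finite_Set.finite_set infinite_UNIV_nat by blast
  obtain g :: "nat set \<times> nat \<Rightarrow> 'a" where g: "\<And>h. \<exists>!j. h \<in> (+) (g j) ` (B0 \<union> B1)"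
    by (rule reindex_translates[OF X(2) ordIso_transitive[OF X(1) ordIso_symmetric[OF cardI]]]) (rule that)
  define T where "T = (\<lambda>j. (+) (g j) ` (B0 \<union> B1))"
  define M where "M = (\<lambda>j. (+) (g j) ` B1)"
  have TM: "T j - M j = (+) (g j) ` B0" for j
  proof -
    have "(B0 \<union> B1) - B1 = B0" using B(2) by blast
    then show ?thesis by (simp add: T_def M_def image_set_diff[symmetric])
  qed
  \<comment> \<open>There are continuum many indices and at most continuum many copies of each set,
    whereas \<open>M j\<close> has \<open>2 ^ \<kappa>\<close> subsets.\<close>
  have many: "\<not> |Pow (M j)| \<le>o |\<Union>i::nat set \<times> nat. {C::'a set. A i homeomorphic C}|" for A :: "nat set \<times> nat \<Rightarrow> 'a set" and j
  proof
    assume le: "|Pow (M j)| \<le>o |\<Union>i::nat set \<times> nat. {C::'a set. A i homeomorphic C}|"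
    have "|{C::'a set. A i homeomorphic C}| \<le>o |UNIV :: nat set set|" for i
      by (rule ordLeq_transitive[OF card_of_homeomorphic_copies
            card_of_seq_le_continuum[OF card_of_second_countable_t2]])
    then have "|\<Union>i::nat set \<times> nat. {C::'a set. A i homeomorphic C}| \<le>o |UNIV :: nat set set|"
      using ordIso_imp_ordLeq[OF cardI] by (intro UNION_Cinfinite_bound Cinfinite_card_of infc ballI)
    then have 1: "|Pow (M j)| \<le>o continuum"
      using le continuum_ordIso ordIso_symmetric ordLeq_ordIso_trans ordLeq_transitive by blast
    have "card_dense \<kappa> (M j)" unfolding M_def by (rule card_dense_translate[OF B(4)])
    then have "|M j| =o \<kappa>" unfolding card_dense_def by (metis Int_UNIV_right UNIV_not_empty open_UNIV)
    then have "|Field \<kappa>| =o |M j|"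
      using card_of_Field_ordIso[OF \<kappa>(1)] ordIso_symmetric ordIso_transitive by blast
    then obtain h where "bij_betw h (Field \<kappa>) (M j)" using card_of_ordIso by blast
    then have "bij_betw (image h) (Pow (Field \<kappa>)) (Pow (M j))" by (rule bij_betw_Pow)
    then have "|Pow (Field \<kappa>)| =o |Pow (M j)|" using card_of_ordIso by blast
    then have "ctwo ^c \<kappa> =o |Pow (M j)|" using ctwo_cexp_ordIso ordIso_transitive by blast
    then have "continuum <o |Pow (M j)|" using big ordLess_ordIso_trans by blast
    then show False using 1 not_ordLess_ordLeq by blast
  qed
  have MT: "M j \<subseteq> T j" for j by (auto simp: M_def T_def)
  have T1: "\<exists>!i. x \<in> T i" for x unfolding T_def by (rule g)
  obtain S where S: "\<And>i. T i - M i \<subseteq> S i" "\<And>i. \<exists>j. S i \<subseteq> T i \<union> T j" "\<And>x. \<exists>!i. x \<in> S i"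
    "\<And>i j. i \<noteq> j \<Longrightarrow> \<not> S i homeomorphic S j"
    by (rule exchange_partition[where E = "(homeomorphic)", OF T1 MT many homeomorphic_sym[THEN iffD1]])
      (assumption, rule that)
  have TL: "T i \<in> \<L>" for i using \<L>(2) B(1) by (auto simp: T_def translation_invariant_def)
  have cT: "|T i| \<le>o \<kappa>" for i
    unfolding T_def by (rule ordLeq_ordIso_trans[OF card_of_image B(5)])
  have cinf: "Cinfinite \<kappa>" using \<kappa> cinfinite_mono natLeq_cinfinite by blast
  have dense: "card_dense \<kappa> (S i)" for i
  proof (rule card_dense_superset[OF _ S(1)])
    show "card_dense \<kappa> (T i - M i)" unfolding TM by (rule card_dense_translate[OF B(3)])
    obtain j where "S i \<subseteq> T i \<union> T j" using S(2) by blast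
    then show "|S i| \<le>o \<kappa>"
      by (rule ordLeq_transitive[OF card_of_mono1 Un_Cinfinite_bound[OF cT cT cinf]])
  qed
  have ne: "S i \<noteq> {}" for i using card_dense_nonempty[OF dense \<kappa>(2)] .
  show ?thesis
  proof (intro exI[of _ "range S"] conjI)
    have "S i \<in> \<L>" for i
    proof -
      obtain j where "S i \<subseteq> T i \<union> T j" using S(2) by blast
      then show ?thesis by (rule sigma_ideal_subset[OF \<L>(1) sigma_ideal_Un[OF \<L>(1) TL TL]])
    qed
    then show "range S \<subseteq> \<L>" by blast
    show "partition_on UNIV (range S)" by (rule partition_on_range(1)[OF S(3) ne])
    show "|range S| =o continuum"
      by (rule ordIso_transitive[OF ordIso_transitive[OF partition_on_range(2)[OF S(3) ne] cardI]
            ordIso_symmetric[OF continuum_ordIso]])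
    show "\<forall>S\<in>range S. card_dense \<kappa> S" using dense by blast
    show "\<forall>A\<in>range S. \<forall>C\<in>range S. A \<noteq> C \<longrightarrow> \<not> A homeomorphic C"
    proof (intro ballI impI)
      fix A C assume "A \<in> range S" "C \<in> range S" "A \<noteq> C"
      then obtain i j where ij: "A = S i" "C = S j" by (elim imageE) (rule that)
      then have "i \<noteq> j" using \<open>A \<noteq> C\<close> by auto
      then show "\<not> A homeomorphic C" unfolding ij by (rule S(4))
    qed
  qed
qed

subsection \<open>Cantor-Bendixson codes\<close>

text \<open>The derivative is formed inside \<open>Z\<close>: limit points that \<open>Z\<close>
  lacks do not count. This makes every stage a topological invariant of the subspace.\<close>

primrec cb_derivative :: "nat \<Rightarrow> 'a::topological_space set \<Rightarrow> 'a set" where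
  "cb_derivative 0 Z = Z"
| "cb_derivative (Suc n) Z = {x \<in> cb_derivative n Z. x islimpt cb_derivative n Z}"

definition locally_compact_at :: "'a::topological_space set \<Rightarrow> 'a \<Rightarrow> bool" where
  "locally_compact_at Z x \<longleftrightarrow> (\<exists>U K. open U \<and> x \<in> U \<and> compact K \<and> U \<inter> Z \<subseteq> K \<and> K \<subseteq> Z)"

text \<open>Occupied ranks alone carry little information: a point of rank \<open>n + 1\<close> has
  points of rank \<open>n\<close> nearby, so these ranks form an initial segment. Failure of local
  compactness is the mark that singles out chosen ranks.\<close>

definition rank_code :: "'a::topological_space set \<Rightarrow> nat set" where
  "rank_code Z = {n. \<exists>x \<in> cb_derivative n Z - cb_derivative (Suc n) Z. \<not> locally_compact_at Z x}"

section \<open>Invariance of the rank code under homeomorphisms\<close>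

lemma cb_antimono: "m \<le> n \<Longrightarrow> cb_derivative n Z \<subseteq> cb_derivative m Z"
  by (induction rule: dec_induct) auto

lemma cb_subset: "cb_derivative n Z \<subseteq> Z"
  using cb_antimono[of 0 n Z] by simp

lemma islimpt_iff_not_openin_singleton:
  assumes "x \<in> A"
  shows "x islimpt A \<longleftrightarrow> \<not> openin (top_of_set A) {x}"
proof -
  have "openin (top_of_set A) {x} \<longleftrightarrow> (\<exists>T. open T \<and> {x} = A \<inter> T)"
    by (simp add: openin_open)
  also have "\<dots> \<longleftrightarrow> \<not> x islimpt A"
    using assms unfolding islimpt_def by blast
  finally show ?thesis by blast
qed

lemma homeomorphism_islimpt:
  assumes h: "homeomorphism A A' f g" and x: "x \<in> A" "x islimpt A"
  shows "f x islimpt A'"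
proof (rule ccontr)
  have y: "f x \<in> A'" "g (f x) = x" using h x(1) by (auto simp: homeomorphism_def)
  assume "\<not> f x islimpt A'"
  then have "openin (top_of_set A') {f x}" using islimpt_iff_not_openin_singleton[OF y(1)] by blast
  then have "openin (top_of_set A) (g ` {f x})"
    by (rule homeomorphism_imp_open_map[OF homeomorphism_symD[OF h]])
  then show False using islimpt_iff_not_openin_singleton[OF x(1)] x(2) y(2) by simp
qed

lemma homeomorphism_cb:
  assumes "homeomorphism Z Z' f g"
  shows "homeomorphism (cb_derivative n Z) (cb_derivative n Z') f g"
proof (induction n)
  case 0
  then show ?case using assms by simp
next
  case (Suc n)
  have 1: "f x \<in> cb_derivative (Suc n) Z'" if "x \<in> cb_derivative (Suc n) Z" for x
    using that homeomorphism_islimpt[OF Suc] Suc by (auto simp: homeomorphism_def)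
  have 2: "g y \<in> cb_derivative (Suc n) Z" "f (g y) = y" if "y \<in> cb_derivative (Suc n) Z'" for y
    using that homeomorphism_islimpt[OF homeomorphism_symD[OF Suc]] Suc by (auto simp: homeomorphism_def)
  have "f ` cb_derivative (Suc n) Z = cb_derivative (Suc n) Z'"
  proof (intro equalityI subsetI)
    fix y assume "y \<in> cb_derivative (Suc n) Z'"
    then show "y \<in> f ` cb_derivative (Suc n) Z" using 2 by (metis imageI)
  qed (use 1 in blast)
  then show ?case by (intro homeomorphism_of_subsets[OF Suc]) auto
qed

lemma homeomorphism_locally_compact_at:
  assumes h: "homeomorphism Z Z' f g" and x: "x \<in> Z" "locally_compact_at Z x"
  shows "locally_compact_at Z' (f x)"
proof -
  obtain U K where U: "open U" "x \<in> U" "compact K" "U \<inter> Z \<subseteq> K" "K \<subseteq> Z"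
    using x(2) unfolding locally_compact_at_def by blast
  have "openin (top_of_set Z) (Z \<inter> U)" using U(1) by (rule openin_open_Int)
  then have "openin (top_of_set Z') (f ` (Z \<inter> U))" by (rule homeomorphism_imp_open_map[OF h])
  then obtain U' where U': "open U'" "f ` (Z \<inter> U) = Z' \<inter> U'" by (auto simp: openin_open)
  have cf: "continuous_on Z f" "f ` Z = Z'" using h by (auto simp: homeomorphism_def)
  have "compact (f ` K)"
    using continuous_on_subset[OF cf(1) U(5)] U(3) by (rule compact_continuous_image)
  moreover have "f x \<in> U'" using U' U(2) x(1) by blast
  moreover have "U' \<inter> Z' \<subseteq> f ` K" using U'(2) U(4) by blast
  moreover have "f ` K \<subseteq> Z'" using cf(2) U(5) by blast
  ultimately show ?thesis unfolding locally_compact_at_def using U'(1) by blast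
qed

lemma homeomorphic_cb_code:
  assumes "Z homeomorphic Z'"
  shows "rank_code Z = rank_code Z'"
proof -
  have sub: "rank_code Z \<subseteq> rank_code Z'" if h: "homeomorphism Z Z' f g"
    for Z :: "'x::topological_space set" and Z' :: "'y::topological_space set" and f g
  proof
    fix n assume "n \<in> rank_code Z"
    then obtain x where x: "x \<in> cb_derivative n Z" "x \<notin> cb_derivative (Suc n) Z" "\<not> locally_compact_at Z x"
      unfolding rank_code_def by blast
    have xZ: "x \<in> Z" using x(1) cb_subset by blast
    then have fx: "f x \<in> Z'" "g (f x) = x" using h by (auto simp: homeomorphism_def)
    have "f x \<in> cb_derivative n Z'" using homeomorphism_cb[OF h, of n] x(1) by (auto simp: homeomorphism_def)
    moreover have "f x \<notin> cb_derivative (Suc n) Z'"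
    proof
      assume "f x \<in> cb_derivative (Suc n) Z'"
      then have "g (f x) \<in> cb_derivative (Suc n) Z"
        using homeomorphism_cb[OF h, of "Suc n"] unfolding homeomorphism_def by blast
      then show False using x(2) fx(2) by simp
    qed
    moreover have "\<not> locally_compact_at Z' (f x)"
      using homeomorphism_locally_compact_at[OF homeomorphism_symD[OF h] fx(1)] fx(2) x(3) by auto
    ultimately show "n \<in> rank_code Z'" unfolding rank_code_def by blast
  qed
  obtain f g where h: "homeomorphism Z Z' f g" using assms by (auto simp: homeomorphic_def)
  show ?thesis using sub[OF h] sub[OF homeomorphism_symD[OF h]] by blast
qed

section \<open>Local nature of ranks and of local compactness\<close>

lemma islimpt_Int_open: "open U \<Longrightarrow> x \<in> U \<Longrightarrow> x islimpt (A \<inter> U) \<longleftrightarrow> x islimpt A"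
  unfolding islimpt_def by (metis Int_iff open_Int)

lemma cb_Int_open: "open U \<Longrightarrow> cb_derivative n (Z \<inter> U) = cb_derivative n Z \<inter> U"
  by (induction n) (auto simp: islimpt_Int_open)

lemma locally_compact_at_Int_open:
  fixes Z :: "real set"
  assumes "open U" "x \<in> U" "x \<in> Z"
  shows "locally_compact_at (Z \<inter> U) x \<longleftrightarrow> locally_compact_at Z x"
proof
  assume "locally_compact_at (Z \<inter> U) x"
  then obtain V K where "open V" "x \<in> V" "compact K" "V \<inter> (Z \<inter> U) \<subseteq> K" "K \<subseteq> Z \<inter> U"
    unfolding locally_compact_at_def by blast
  then show "locally_compact_at Z x" unfolding locally_compact_at_def
    using assms by (intro exI[of _ "V \<inter> U"] exI[of _ K]) auto
next
  assume "locally_compact_at Z x"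
  then obtain V K where V: "open V" "x \<in> V" "compact K" "V \<inter> Z \<subseteq> K" "K \<subseteq> Z"
    unfolding locally_compact_at_def by blast
  \<comment> \<open>A closed ball inside \<open>U\<close> cuts \<open>K\<close> down to a compact
    set that lies in \<open>Z \<inter> U\<close>.\<close>
  obtain e where e: "e > 0" "cball x e \<subseteq> U" using assms open_contains_cball by blast
  have "compact (K \<inter> cball x e)" using V(3) by (intro compact_Int_closed) auto
  moreover have "V \<inter> ball x e \<inter> (Z \<inter> U) \<subseteq> K \<inter> cball x e" using V(4) by auto
  moreover have "K \<inter> cball x e \<subseteq> Z \<inter> U" using V(5) e(2) by blast
  moreover have "open (V \<inter> ball x e)" "x \<in> V \<inter> ball x e" using V(1,2) e(1) by auto
  ultimately show "locally_compact_at (Z \<inter> U) x" unfolding locally_compact_at_def by blast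
qed

lemma locally_compact_at_compact: "compact Z \<Longrightarrow> locally_compact_at Z x"
  unfolding locally_compact_at_def by (intro exI[of _ UNIV] exI[of _ Z]) auto

text \<open>This is the largest relatively open, locally countable part of \<open>S\<close>.\<close>

definition countable_points :: "'a::topological_space set \<Rightarrow> 'a set" where
  "countable_points S = {x \<in> S. \<exists>U. open U \<and> x \<in> U \<and> countable (U \<inter> S)}"

text \<open>The relative boundary in \<open>S\<close> of that open part. The closure is taken in the
  ambient space, but intersecting with \<open>S\<close> makes the result intrinsic to the
  subspace.\<close>

definition countable_boundary :: "'a::topological_space set \<Rightarrow> 'a set" where
  "countable_boundary S = (S - countable_points S) \<inter> closure (countable_points S)"

lemma homeomorphic_countable_boundary:
  assumes "S homeomorphic S'"
  shows "countable_boundary S homeomorphic countable_boundary S'"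
proof -
  have cp: "f ` countable_points S \<subseteq> countable_points S'" if h: "homeomorphism S S' f g"
    for S :: "'x::topological_space set" and S' :: "'y::topological_space set" and f g
  proof
    fix y assume "y \<in> f ` countable_points S"
    then obtain x U where x: "y = f x" "x \<in> S" "open U" "x \<in> U" "countable (U \<inter> S)"
      by (auto simp: countable_points_def)
    have "openin (top_of_set S') (f ` (S \<inter> U))"
      by (rule homeomorphism_imp_open_map[OF h openin_open_Int[OF x(3)]])
    then obtain U' where U': "open U'" "f ` (S \<inter> U) = S' \<inter> U'" by (auto simp: openin_open)
    have "countable (f ` (U \<inter> S))" using x(5) by (rule countable_image)
    then have "countable (U' \<inter> S')" using U'(2) by (simp add: Int_commute)
    moreover have "y \<in> S' \<inter> U'" using U'(2) x by blast
    ultimately show "y \<in> countable_points S'" using U'(1) by (auto simp: countable_points_def)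
  qed
  have bd: "f ` countable_boundary S \<subseteq> countable_boundary S'" if h: "homeomorphism S S' f g"
    for S :: "'x::topological_space set" and S' :: "'y::topological_space set" and f g
  proof
    fix y assume "y \<in> f ` countable_boundary S"
    then obtain x where x: "y = f x" "x \<in> S" "x \<notin> countable_points S" "x \<in> closure (countable_points S)"
      by (auto simp: countable_boundary_def)
    have y: "y \<in> S'" "g y = x" using h x by (auto simp: homeomorphism_def)
    have "y \<notin> countable_points S'" using cp[OF homeomorphism_symD[OF h]] y(2) x(3) by blast
    moreover have "y \<in> closure (countable_points S')"
    proof -
      have sub: "countable_points S \<subseteq> S" by (auto simp: countable_points_def)
      have "continuous_map (top_of_set S) euclidean f" using h by (simp add: homeomorphism_def)
      then have "f ` (top_of_set S closure_of countable_points S) \<subseteq> euclidean closure_of (f ` countable_points S)"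
        by (rule continuous_map_image_closure_subset)
      moreover have "x \<in> top_of_set S closure_of countable_points S"
        using x(2,4) sub by (simp add: closure_of_subtopology Int_absorb1)
      ultimately have "y \<in> closure (f ` countable_points S)" using x(1) by auto
      then show ?thesis using closure_mono[OF cp[OF h]] by blast
    qed
    ultimately show "y \<in> countable_boundary S'" using y(1) by (simp add: countable_boundary_def)
  qed
  obtain f g where h: "homeomorphism S S' f g" using assms by (auto simp: homeomorphic_def)
  have sub: "countable_boundary S \<subseteq> S" "countable_boundary S' \<subseteq> S'" by (auto simp: countable_boundary_def)
  have "\<forall>y\<in>countable_boundary S'. f (g y) = y" using h sub by (auto simp: homeomorphism_def)
  then have "f ` countable_boundary S = countable_boundary S'"
    using bd[OF h] bd[OF homeomorphism_symD[OF h]] by force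
  then show ?thesis using homeomorphism_of_subsets[OF h sub] by (auto simp: homeomorphic_def)
qed

text \<open>Compact pieces accumulating at \<open>p\<close>. Each window \<open>I k\<close> isolates
  one piece, so ranks and local compactness away from \<open>p\<close> are computed piece by piece.
  The later intersection with \<open>T\<close> either keeps \<open>p\<close> or leaves a hole
  there.\<close>

locale real_join =
  fixes p :: real and F I :: "nat \<Rightarrow> real set"
  assumes nbhd: "\<And>k. open (I k)" "\<And>k. p \<notin> I k" "\<And>k. insert p (\<Union>k. F k) \<inter> I k = F k"
    and pieces: "\<And>k. compact (F k)" "\<And>k. countable (F k)"
    and near: "\<And>W. open W \<Longrightarrow> p \<in> W \<Longrightarrow> \<exists>k. I k \<subseteq> W"
begin

definition join :: "real set" where "join = insert p (\<Union>k. F k)"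

lemma join_Int: "(join \<inter> T) \<inter> I k = F k \<inter> T"
  using nbhd(3)[of k] by (auto simp: join_def)

lemma join_cases: "x \<in> join \<inter> T \<Longrightarrow> x = p \<or> (\<exists>k. x \<in> F k \<inter> T \<and> x \<in> I k)"
  using nbhd(3) by (auto simp: join_def)

lemma cb_join: "cb_derivative n (join \<inter> T) \<inter> I k = cb_derivative n (F k \<inter> T)"
  using cb_Int_open[OF nbhd(1)[of k], of n "join \<inter> T"] by (simp add: join_Int)

lemma locally_compact_at_join: "x \<in> F k \<inter> T \<Longrightarrow> locally_compact_at (join \<inter> T) x \<longleftrightarrow> locally_compact_at (F k \<inter> T) x"
  using locally_compact_at_Int_open[OF nbhd(1)[of k], of x "join \<inter> T"] join_Int[of T k] by auto

lemma cb_join_diff: "cb_derivative n (join \<inter> T) - {p} = (\<Union>k. cb_derivative n (F k \<inter> T))"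
proof -
  have "x \<in> (\<Union>k. cb_derivative n (F k \<inter> T))" if x: "x \<in> cb_derivative n (join \<inter> T)" "x \<noteq> p" for x
  proof -
    have "x \<in> join \<inter> T" using x(1) cb_subset by blast
    then obtain k where "x \<in> I k" using join_cases x(2) by blast
    then show ?thesis using cb_join[of n T k] x(1) by blast
  qed
  moreover have "x \<in> cb_derivative n (join \<inter> T) - {p}" if "x \<in> cb_derivative n (F k \<inter> T)" for x k
    using that cb_join[of n T k] nbhd(2)[of k] by auto
  ultimately show ?thesis by blast
qed

text \<open>Windows arbitrarily close to \<open>p\<close> contain points of every derivative up to
  \<open>n\<close>, so \<open>p\<close> survives one stage longer than the pieces and is then
  alone.\<close>

lemma cb_join_point:
  assumes pT: "p \<in> T" and ne: "\<And>k. cb_derivative n (F k \<inter> T) \<noteq> {}" and em: "\<And>k. cb_derivative (Suc n) (F k \<inter> T) = {}"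
  shows "m \<le> Suc n \<Longrightarrow> p \<in> cb_derivative m (join \<inter> T)" "cb_derivative (Suc n) (join \<inter> T) = {p}"
    "cb_derivative (Suc (Suc n)) (join \<inter> T) = {}"
proof -
  have p: "p \<in> cb_derivative m (join \<inter> T)" if "m \<le> Suc n" for m
    using that
  proof (induction m)
    case 0
    then show ?case using pT by (simp add: join_def)
  next
    case (Suc m)
    have "p islimpt cb_derivative m (join \<inter> T)"
    proof (rule islimptI)
      fix W assume "p \<in> W" "open W"
      then obtain k where k: "I k \<subseteq> W" using near by blast
      have "cb_derivative m (F k \<inter> T) \<noteq> {}" using ne[of k] cb_antimono[of m n "F k \<inter> T"] Suc.prems by auto
      then obtain y where "y \<in> cb_derivative m (join \<inter> T)" "y \<in> I k" using cb_join[of m T k] by blast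
      then show "\<exists>y\<in>cb_derivative m (join \<inter> T). y \<in> W \<and> y \<noteq> p" using k nbhd(2)[of k] by blast
    qed
    then show ?case using Suc by simp
  qed
  then show "m \<le> Suc n \<Longrightarrow> p \<in> cb_derivative m (join \<inter> T)" .
  have "cb_derivative (Suc n) (join \<inter> T) - {p} = {}" unfolding cb_join_diff using em by blast
  then show eq: "cb_derivative (Suc n) (join \<inter> T) = {p}" using p[of "Suc n"] by blast
  have "\<not> p islimpt {p}" by (simp add: islimpt_finite)
  then show "cb_derivative (Suc (Suc n)) (join \<inter> T) = {}" unfolding cb_derivative.simps(2)[of "Suc n"] eq by blast
qed

end

lemma real_join_exists:
  fixes U :: "real set" and P :: "nat \<Rightarrow> real set \<Rightarrow> bool"
  assumes U: "open U" "p \<in> U"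
    and ex: "\<And>k V. open V \<Longrightarrow> V \<noteq> {} \<Longrightarrow> \<exists>F. P k F \<and> compact F \<and> countable F \<and> F \<subseteq> V"
  obtains F I where "real_join p F I" "\<And>k. P k (F k)" "compact (real_join.join p F)"
    "countable (real_join.join p F)" "real_join.join p F \<subseteq> U" "p \<in> real_join.join p F"
proof -
  obtain e where e: "e > 0" "cball p e \<subseteq> U" using U open_contains_cball by blast
  \<comment> \<open>Disjoint open intervals shrinking to \<open>p\<close> from the right;
    neighbouring ones share just an endpoint that belongs to neither.\<close>
  define I where "I = (\<lambda>k::nat. {p + e / (k + 2) <..< p + e / (k + 1)})"
  have oI: "open (I k)" for k by (simp add: I_def)
  have neI: "I k \<noteq> {}" for k
  proof -
    have "e / (real k + 2) < e / (real k + 1)" using e(1) by (intro divide_strict_left_mono) auto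
    then show ?thesis by (simp add: I_def)
  qed
  have "\<forall>k. \<exists>F. P k F \<and> compact F \<and> countable F \<and> F \<subseteq> I k" using ex[OF oI neI] by blast
  then obtain F where "\<forall>k. P k (F k) \<and> compact (F k) \<and> countable (F k) \<and> F k \<subseteq> I k"
    using choice[of "\<lambda>k F. P k F \<and> compact F \<and> countable F \<and> F \<subseteq> I k"] by blast
  then have F: "\<And>k. P k (F k)" "\<And>k. compact (F k)" "\<And>k. countable (F k)" "\<And>k. F k \<subseteq> I k"
    by blast+
  have pI: "p \<notin> I k" for k using e(1) by (auto simp: I_def field_simps)
  have mono: "e / (real l + 1) \<le> e / (real k + 2)" if "k < l" for k l :: nat
    using that e(1) by (intro divide_left_mono) auto
  have disj: "I k \<inter> I l = {}" if "k < l" for k l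
    using mono[OF that] by (auto simp: I_def)
  have disj': "I k \<inter> I l = {}" if "k \<noteq> l" for k l
    using disj[of k l] disj[of l k] that by (cases "k < l") auto
  have II: "insert p (\<Union>k. F k) \<inter> I k = F k" for k
  proof -
    have "l = k" if "x \<in> F l" "x \<in> I k" for x l using F(4)[of l] disj'[of l k] that by blast
    then show ?thesis using pI[of k] F(4)[of k] by blast
  qed
  have small: "\<exists>N::nat. e / (real N + 1) < d" if "d > 0" for d
  proof -
    obtain N :: nat where "e / d < N" using reals_Archimedean2 by blast
    then have "e / (real N + 1) < d" using that e(1) by (simp add: field_simps)
    then show ?thesis by blast
  qed
  have near: "\<exists>k. I k \<subseteq> W" if "open W" "p \<in> W" for W
  proof -
    obtain d where d: "d > 0" "ball p d \<subseteq> W" using \<open>open W\<close> \<open>p \<in> W\<close> open_contains_ball by blast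
    obtain N :: nat where N: "e / (real N + 1) < d" using small[OF d(1)] by blast
    have "0 < e / (real N + 2)" using e(1) by simp
    then have "I N \<subseteq> ball p d" using N by (auto simp: I_def dist_real_def)
    then show ?thesis using d(2) by blast
  qed
  have rj: "real_join p F I"
    by unfold_locales (use oI pI II F near in auto)
  let ?J = "insert p (\<Union>k. F k)"
  have J: "real_join.join p F = ?J" by (rule real_join.join_def[OF rj])
  have Isub: "I k \<subseteq> {p..p + e / (real N + 1)}" if "N \<le> k" for k N
  proof -
    have "e / (real k + 1) \<le> e / (real N + 1)" using that e(1) by (intro divide_left_mono) auto
    moreover have "0 < e / (real k + 2)" using e(1) by simp
    ultimately show ?thesis unfolding I_def by (intro subsetI) (simp only: atLeastAtMost_iff greaterThanLessThan_iff; linarith)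
  qed
  \<comment> \<open>Closedness comes from this formula: all but the first \<open>N\<close> pieces
    lie in a short closed interval starting at \<open>p\<close>.\<close>
  have "?J = (\<Inter>N. {p..p + e / (real N + 1)} \<union> (\<Union>k<N. F k))"
  proof (intro equalityI subsetI)
    fix x assume x: "x \<in> ?J"
    have "x \<in> {p..p + e / (real N + 1)} \<union> (\<Union>k<N. F k)" for N
    proof (cases "x = p")
      case True
      then show ?thesis using e(1) by simp
    next
      case False
      then obtain k where k: "x \<in> F k" using x by blast
      show ?thesis
      proof (cases "k < N")
        case False
        then show ?thesis using Isub[of N k] F(4)[of k] k by auto
      qed (use k in blast)
    qed
    then show "x \<in> (\<Inter>N. {p..p + e / (real N + 1)} \<union> (\<Union>k<N. F k))" by blast
  next
    fix x assume x: "x \<in> (\<Inter>N. {p..p + e / (real N + 1)} \<union> (\<Union>k<N. F k))"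
    show "x \<in> ?J"
    proof (rule ccontr)
      assume nJ: "x \<notin> ?J"
      then have b: "p \<le> x \<and> x \<le> p + e / (real N + 1)" for N
        using x by (auto dest!: INT_D[of _ _ _ N])
      have "x - p > 0" using b[of 0] nJ by auto
      then obtain N where "e / (real N + 1) < x - p" using small by blast
      then show False using b[of N] by linarith
    qed
  qed
  moreover have "closed \<dots>"
    by (intro closed_INT ballI closed_Un closed_UN closed_atLeastAtMost) (auto intro: compact_imp_closed F)
  ultimately have clJ: "closed ?J" by simp
  have sub: "?J \<subseteq> {p..p + e}"
    using Isub[of 0] F(4) e(1) by fastforce
  have "bounded ?J" using bounded_subset[OF bounded_closed_interval sub] .
  then have "compact ?J" using clJ compact_eq_bounded_closed by blast
  moreover have "{p..p + e} \<subseteq> cball p e" by (auto simp: dist_real_def)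
  then have "?J \<subseteq> U" using sub e(2) by blast
  ultimately show ?thesis using that[OF rj F(1)] F(3) J by simp
qed

text \<open>Modelled on the ordinal \<open>omega ^ n + 1\<close>: a single point for
  \<open>n = 0\<close>, then a sequence of blocks converging to a new point of
  \<open>T\<close>.\<close>

lemma rank_block_exists:
  fixes T U :: "real set"
  assumes T: "\<And>V. open V \<Longrightarrow> V \<noteq> {} \<Longrightarrow> V \<inter> T \<noteq> {}" and U: "open U" "U \<noteq> {}"
  shows "\<exists>F. (F \<subseteq> T \<and> cb_derivative n F \<noteq> {} \<and> cb_derivative (Suc n) F = {}) \<and> compact F \<and> countable F \<and> F \<subseteq> U"
  using U
proof (induction n arbitrary: U)
  case 0
  then obtain p where "p \<in> U" "p \<in> T" using T by blast
  then show ?case by (intro exI[of _ "{p}"]) (auto simp: islimpt_finite)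
next
  case (Suc n)
  obtain p where p: "p \<in> U" "p \<in> T" using T Suc.prems by blast
  obtain F I where F: "real_join p F I"
    "\<And>k::nat. F k \<subseteq> T \<and> cb_derivative n (F k) \<noteq> {} \<and> cb_derivative (Suc n) (F k) = {}" "compact (real_join.join p F)"
    "countable (real_join.join p F)" "real_join.join p F \<subseteq> U"
    by (rule real_join_exists[where P = "\<lambda>_ F. F \<subseteq> T \<and> cb_derivative n F \<noteq> {} \<and> cb_derivative (Suc n) F = {}",
          OF Suc.prems(1) p(1) Suc.IH]) (assumption+, rule that)
  interpret real_join p F I by (rule F(1))
  have FT: "F k \<inter> T = F k" for k using F(2)[of k] by blast
  have JT: "join \<inter> T = join" using F(2) p(2) by (auto simp: join_def)
  have "cb_derivative (Suc n) join = {p}" "cb_derivative (Suc (Suc n)) join = {}"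
    using cb_join_point(2,3)[of T n] F(2) p(2) by (simp_all only: FT JT) blast+
  then show ?case using F(3-5) JT by (intro exI[of _ join]) auto
qed

text \<open>Here the limit point is chosen outside \<open>T\<close>. The trace
  \<open>F \<inter> T\<close> remains locally compact, but its closure has a point missing from
  \<open>T\<close>, so no compact subset of \<open>T\<close> contains the trace.\<close>

lemma noncompact_block_exists:
  fixes T U :: "real set"
  assumes T: "\<And>V. open V \<Longrightarrow> V \<noteq> {} \<Longrightarrow> V \<inter> T \<noteq> {}" "\<And>V. open V \<Longrightarrow> V \<noteq> {} \<Longrightarrow> V - T \<noteq> {}"
    and U: "open U" "U \<noteq> {}"
  shows "\<exists>F. (cb_derivative n (F \<inter> T) \<noteq> {} \<and> cb_derivative (Suc n) (F \<inter> T) = {} \<and> (\<forall>x\<in>F \<inter> T. locally_compact_at (F \<inter> T) x) \<and>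
    (\<exists>y\<in>closure (F \<inter> T). y \<notin> T)) \<and> compact F \<and> countable F \<and> F \<subseteq> U"
proof -
  obtain p where p: "p \<in> U" "p \<notin> T" using T(2) U by blast
  obtain F I where F: "real_join p F I"
    "\<And>k::nat. F k \<subseteq> T \<and> cb_derivative n (F k) \<noteq> {} \<and> cb_derivative (Suc n) (F k) = {}" "compact (real_join.join p F)"
    "countable (real_join.join p F)" "real_join.join p F \<subseteq> U"
    by (rule real_join_exists[where P = "\<lambda>_ F. F \<subseteq> T \<and> cb_derivative n F \<noteq> {} \<and> cb_derivative (Suc n) F = {}",
          OF U(1) p(1) rank_block_exists[OF T(1)]]) (assumption+, rule that)
  interpret real_join p F I by (rule F(1))
  have FT: "F k \<inter> T = F k" for k using F(2)[of k] by blast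
  have pc: "p \<notin> cb_derivative m (join \<inter> T)" for m using cb_subset p(2) by blast
  have "cb_derivative n (join \<inter> T) \<noteq> {}" using cb_join_diff[of n T] F(2) by (auto simp: FT)
  moreover have "cb_derivative (Suc n) (join \<inter> T) = {}"
    using cb_join_diff[of "Suc n" T] F(2) pc[of "Suc n"] by (simp only: FT) blast
  moreover have "locally_compact_at (join \<inter> T) x" if x: "x \<in> join \<inter> T" for x
  proof -
    obtain k where k: "x \<in> F k \<inter> T" using join_cases[OF x] x p(2) by blast
    have "locally_compact_at (F k \<inter> T) x" unfolding FT by (rule locally_compact_at_compact) (rule pieces(1))
    then show ?thesis using locally_compact_at_join[OF k] by blast
  qed
  moreover have "p \<in> closure (join \<inter> T)"
    unfolding closure_iff_nhds_not_empty
  proof (intro allI impI)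
    fix A V assume "V \<subseteq> A" "open V" "p \<in> V"
    then obtain k where k: "I k \<subseteq> V" using near by blast
    have "F k \<noteq> {}" using F(2)[of k] cb_subset[of n "F k"] by auto
    then obtain x where "x \<in> F k" by blast
    then have "x \<in> join \<inter> T \<inter> I k" unfolding join_Int FT .
    then have "x \<in> join \<inter> T" "x \<in> A" using k \<open>V \<subseteq> A\<close> by auto
    then show "join \<inter> T \<inter> A \<noteq> {}" by (metis IntI empty_iff)
  qed
  ultimately have "cb_derivative n (join \<inter> T) \<noteq> {} \<and> cb_derivative (Suc n) (join \<inter> T) = {} \<and>
    (\<forall>x\<in>join \<inter> T. locally_compact_at (join \<inter> T) x) \<and> (\<exists>y\<in>closure (join \<inter> T). y \<notin> T)"
    using p(2) by metis
  then show ?thesis using F(3-5) by (intro exI[of _ join] conjI) simp_all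
qed

text \<open>Blocks with holes converge to a point \<open>p\<close> of \<open>T\<close>. Every
  neighbourhood of \<open>p\<close> contains the trace of a whole block, so local compactness fails
  at \<open>p\<close>, whose rank is \<open>n + 1\<close>, and nowhere else. Rank 0 cannot be coded,
  because an isolated point has a compact neighbourhood; hence the shift by
  \<open>Suc\<close>.\<close>

lemma rank_code_block_exists:
  fixes T U :: "real set"
  assumes T: "\<And>V. open V \<Longrightarrow> V \<noteq> {} \<Longrightarrow> V \<inter> T \<noteq> {}" "\<And>V. open V \<Longrightarrow> V \<noteq> {} \<Longrightarrow> V - T \<noteq> {}"
    and U: "open U" "U \<noteq> {}"
  shows "\<exists>F. rank_code (F \<inter> T) = {Suc n} \<and> compact F \<and> countable F \<and> F \<subseteq> U"
proof -
  let ?P = "\<lambda>F. cb_derivative n (F \<inter> T) \<noteq> {} \<and> cb_derivative (Suc n) (F \<inter> T) = {} \<and> (\<forall>x\<in>F \<inter> T. locally_compact_at (F \<inter> T) x) \<and>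
    (\<exists>y\<in>closure (F \<inter> T). y \<notin> T)"
  obtain p where p: "p \<in> U" "p \<in> T" using T(1) U by blast
  obtain F I where F: "real_join p F I"
    "\<And>k::nat. ?P (F k)" "compact (real_join.join p F)"
    "countable (real_join.join p F)" "real_join.join p F \<subseteq> U"
    by (rule real_join_exists[where P = "\<lambda>_. ?P",
          OF U(1) p(1) noncompact_block_exists[OF T]]) (assumption+, rule that)
  interpret real_join p F I by (rule F(1))
  have ne: "cb_derivative n (F k \<inter> T) \<noteq> {}" and em: "cb_derivative (Suc n) (F k \<inter> T) = {}" for k using F(2)[of k] by blast+
  note cbp = cb_join_point[OF p(2) ne em]
  have lc: "locally_compact_at (join \<inter> T) x" if x: "x \<in> join \<inter> T" "x \<noteq> p" for x
  proof -
    obtain k where k: "x \<in> F k \<inter> T" using join_cases[OF x(1)] x(2) by blast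
    then have "locally_compact_at (F k \<inter> T) x" using F(2)[of k] by blast
    then show ?thesis using locally_compact_at_join[OF k] by blast
  qed
  have nlc: "\<not> locally_compact_at (join \<inter> T) p"
  proof
    assume "locally_compact_at (join \<inter> T) p"
    then obtain W K where W: "open W" "p \<in> W" "compact K" "W \<inter> (join \<inter> T) \<subseteq> K" "K \<subseteq> join \<inter> T"
      unfolding locally_compact_at_def by blast
    then obtain k where k: "I k \<subseteq> W" using near by blast
    have "F k \<inter> T \<subseteq> K" using join_Int[of T k] k W(4) by blast
    then have "closure (F k \<inter> T) \<subseteq> K" using W(3) by (intro closure_minimal compact_imp_closed)
    then show False using F(2)[of k] W(5) by blast
  qed
  have "rank_code (join \<inter> T) = {Suc n}"
  proof (intro equalityI subsetI)
    fix m assume "m \<in> rank_code (join \<inter> T)"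
    then obtain x where x: "x \<in> cb_derivative m (join \<inter> T)" "x \<notin> cb_derivative (Suc m) (join \<inter> T)" "\<not> locally_compact_at (join \<inter> T) x"
      unfolding rank_code_def by blast
    have "x = p" using lc x(1,3) cb_subset by blast
    then have "\<not> Suc m \<le> Suc n" using cbp(1)[of "Suc m"] x(2) by blast
    moreover have "m < Suc (Suc n)"
    proof (rule ccontr)
      assume "\<not> m < Suc (Suc n)"
      then have "cb_derivative m (join \<inter> T) \<subseteq> {}" using cb_antimono[of "Suc (Suc n)" m "join \<inter> T"] cbp(3) by auto
      then show False using x(1) by blast
    qed
    ultimately show "m \<in> {Suc n}" by simp
  next
    fix m assume "m \<in> {Suc n}"
    then have "p \<in> cb_derivative m (join \<inter> T)" "p \<notin> cb_derivative (Suc m) (join \<inter> T)" using cbp(2,3) by auto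
    then show "m \<in> rank_code (join \<inter> T)" using nlc unfolding rank_code_def by blast
  qed
  then show ?thesis using F(3-5) by blast
qed

lemma rank_code_realized:
  fixes T U :: "real set"
  assumes T: "\<And>V. open V \<Longrightarrow> V \<noteq> {} \<Longrightarrow> V \<inter> T \<noteq> {}" "\<And>V. open V \<Longrightarrow> V \<noteq> {} \<Longrightarrow> V - T \<noteq> {}"
    and U: "open U" "U \<noteq> {}"
  shows "\<exists>F. rank_code (F \<inter> T) = Suc ` N \<and> compact F \<and> countable F \<and> F \<subseteq> U \<and> F \<noteq> {}"
proof -
  \<comment> \<open>Being outside \<open>T\<close>, the limit \<open>p\<close> makes
    \<open>F\<close> compact and nonempty without adding a point to \<open>F \<inter> T\<close>, so
    the codes of the pieces are simply united.\<close>
  obtain p where p: "p \<in> U" "p \<notin> T" using T(2) U by blast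
  have code0: "rank_code ({} :: real set) = {}" using cb_subset by (force simp: rank_code_def)
  have ex: "\<exists>F. rank_code (F \<inter> T) = (if k \<in> N then {Suc k} else {}) \<and> compact F \<and> countable F \<and> F \<subseteq> V"
    if "open V" "V \<noteq> {}" for k V
  proof (cases "k \<in> N")
    case True
    then show ?thesis using rank_code_block_exists[OF T \<open>open V\<close> \<open>V \<noteq> {}\<close>, of k] by simp
  next
    case False
    then show ?thesis using code0 by (intro exI[of _ "{}"]) simp
  qed
  obtain F I where F: "real_join p F I"
    "\<And>k. rank_code (F k \<inter> T) = (if k \<in> N then {Suc k} else {})" "compact (real_join.join p F)"
    "countable (real_join.join p F)" "real_join.join p F \<subseteq> U" "p \<in> real_join.join p F"
    by (rule real_join_exists[where P = "\<lambda>k F. rank_code (F \<inter> T) = (if k \<in> N then {Suc k} else {})",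
          OF U(1) p(1) ex]) (assumption+, rule that)
  interpret real_join p F I by (rule F(1))
  have cb_derivative: "cb_derivative m (join \<inter> T) = (\<Union>k. cb_derivative m (F k \<inter> T))" for m
    using cb_join_diff[of m T] cb_subset[of m "join \<inter> T"] p(2) by blast
  have loc: "x \<in> cb_derivative m (join \<inter> T) \<longleftrightarrow> x \<in> cb_derivative m (F k \<inter> T)" if "x \<in> F k \<inter> T" for x k m
    using cb_join[of m T k] join_Int[of T k] that by blast
  have "m \<in> rank_code (join \<inter> T) \<longleftrightarrow> (\<exists>k. m \<in> rank_code (F k \<inter> T))" for m
  proof
    assume "m \<in> rank_code (join \<inter> T)"
    then obtain x where x: "x \<in> cb_derivative m (join \<inter> T)" "x \<notin> cb_derivative (Suc m) (join \<inter> T)" "\<not> locally_compact_at (join \<inter> T) x"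
      unfolding rank_code_def by blast
    obtain k where k: "x \<in> cb_derivative m (F k \<inter> T)" using x(1) cb_derivative by blast
    then have xk: "x \<in> F k \<inter> T" using cb_subset by blast
    then show "\<exists>k. m \<in> rank_code (F k \<inter> T)"
      using x k loc[OF xk] locally_compact_at_join[OF xk] unfolding rank_code_def by blast
  next
    assume "\<exists>k. m \<in> rank_code (F k \<inter> T)"
    then obtain k x where x: "x \<in> cb_derivative m (F k \<inter> T)" "x \<notin> cb_derivative (Suc m) (F k \<inter> T)" "\<not> locally_compact_at (F k \<inter> T) x"
      unfolding rank_code_def by blast
    then have xk: "x \<in> F k \<inter> T" using cb_subset by blast
    then show "m \<in> rank_code (join \<inter> T)"
      using x loc[OF xk] locally_compact_at_join[OF xk] unfolding rank_code_def by blast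
  qed
  then have "rank_code (join \<inter> T) = Suc ` N" using F(2) by (auto split: if_splits)
  then show ?thesis using F(3-6) by blast
qed

subsection \<open>Locally countable modifications on the real line\<close>

lemma ball_minus_countable_nonempty:
  fixes p :: real
  assumes "countable F" "e > 0"
  obtains x where "dist x p < e" "x \<notin> F"
proof -
  have "uncountable {p - e<..<p + e}" using assms(2) by (simp add: uncountable_open_interval)
  then have "\<not> {p - e<..<p + e} \<subseteq> F" using assms(1) countable_subset by blast
  then obtain x where "x \<in> {p - e<..<p + e}" "x \<notin> F" by blast
  then show ?thesis using that[of x] by (auto simp: dist_real_def abs_less_iff)
qed

text \<open>Around the compact set \<open>F\<close>, the open shells of points at scaled distance between
  consecutive powers of one half from \<open>F\<close> alternate between \<open>V\<close> and \<open>W\<close>. The scale is chosen so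
  that \<open>T\<close> avoids the boundaries of the shells, which is possible as \<open>T\<close> has fewer than continuum
  many points.\<close>
lemma alternating_shells:
  fixes F T :: "real set"
  assumes F: "compact F" "F \<noteq> {}" "countable F" and T: "|T| <o |UNIV :: real set|" "infinite T"
  obtains V W where "open V" "open W" "V \<inter> W = {}" "V \<inter> F = {}" "W \<inter> F = {}" "T \<subseteq> V \<union> W \<union> F"
    "F \<subseteq> closure V" "F \<subseteq> closure W" "\<And>x. x \<in> V \<Longrightarrow> infdist x F < 1"
proof -
  define L where "L = (\<lambda>m y. (1/2::real) ^ Suc m < y \<and> y < (1/2) ^ m)"
  have L_le: "m \<ge> m'" if "L m y" "L m' y" for m m' y
  proof (rule ccontr)
    assume "\<not> m \<ge> m'"
    then have "(1/2::real) ^ m' \<le> (1/2) ^ Suc m" by (intro power_decreasing) auto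
    then show False using that by (auto simp: L_def)
  qed
  have L_uniq: "m = m'" if "L m y" "L m' y" for m m' y using L_le[of m y m'] L_le[of m' y m] that by simp
  have L_pos: "y > 0" if "L m y" for m y
    using that zero_less_power[of "1/2::real" "Suc m"] by (simp only: L_def) linarith
  have L_1: "y < 1" if "L m y" for m y
    using that power_le_one[of "1/2::real" m] by (auto simp: L_def)
  have L_ex: "\<exists>m. L m y" if y: "0 < y" "y < 1" "\<And>j::nat. y \<noteq> (1/2) ^ j" for y
  proof -
    have ex: "\<exists>n. (1/2::real) ^ n < y" using real_arch_pow_inv[of y "1/2"] y(1) by simp
    define n where "n = (LEAST n. (1/2::real) ^ n < y)"
    have n: "(1/2::real) ^ n < y" unfolding n_def using LeastI_ex[OF ex] .
    then obtain m where m: "n = Suc m" using y(2) by (cases n) auto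
    have "\<not> (1/2::real) ^ m < y" using not_less_Least[of m "\<lambda>n. (1/2::real) ^ n < y"] m n_def by simp
    then have "y < (1/2) ^ m" using y(3)[of m] by simp
    then show ?thesis using n m by (auto simp: L_def)
  qed
  have clF: "closed F" using F(1) by (rule compact_imp_closed)
  let ?d = "\<lambda>x. infdist x F"
  \<comment> \<open>A scale is bad if it puts a point of \<open>T\<close> at a boundary value; each
    point spoils countably many scales. For \<open>t \<in> F\<close> the division by zero gives 0,
    which is not among the scales above 1.\<close>
  define bad where "bad = (\<Union>t\<in>T. range (\<lambda>j::nat. (1/2) ^ j / ?d t))"
  have "|bad| \<le>o |T|"
    unfolding bad_def using T(2)
    by (intro UNION_Cinfinite_bound Cinfinite_card_of ballI) (auto intro: countable_ordLeq_infinite card_of_mono1)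
  then have "|bad| <o |UNIV :: real set|" using T(1) ordLeq_ordLess_trans by blast
  moreover have "|UNIV :: real set| \<le>o |{1<..} :: real set|"
  proof -
    have "inj_on (\<lambda>x::real. 1 + exp x) UNIV" by (auto simp: inj_on_def)
    moreover have "(\<lambda>x::real. 1 + exp x) ` UNIV \<subseteq> {1<..}" by auto
    ultimately show ?thesis using card_of_ordLeq by blast
  qed
  ultimately have "|bad| <o |{1<..} :: real set|" using ordLess_ordLeq_trans by blast
  then obtain s :: real where s: "s > 1" "s \<notin> bad" using ordLess_exists_diff by fastforce
  define V where "V = {x. \<exists>m. even m \<and> L m (s * ?d x)}"
  \<comment> \<open>The region at scaled distance above 1 is added to \<open>W\<close>, so that off
    \<open>F\<close> only the shell boundaries are left out.\<close>
  define W where "W = {x. (\<exists>m. odd m \<and> L m (s * ?d x)) \<or> 1 < s * ?d x}"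
  have oL: "open {x. L m (s * ?d x)}" for m
    unfolding L_def by (intro open_Collect_conj open_Collect_less continuous_intros)
  have "V = (\<Union>m\<in>{m. even m}. {x. L m (s * ?d x)})" by (auto simp: V_def)
  then have oV: "open V" using oL by auto
  have "W = (\<Union>m\<in>{m. odd m}. {x. L m (s * ?d x)}) \<union> {x. 1 < s * ?d x}" by (auto simp: W_def)
  moreover have "open {x. 1 < s * ?d x}" by (intro open_Collect_less continuous_intros)
  ultimately have oW: "open W" using oL by auto
  have VW: "V \<inter> W = {}"
  proof -
    have False if "x \<in> V" "x \<in> W" for x
    proof -
      obtain m where m: "even m" "L m (s * ?d x)" using \<open>x \<in> V\<close> by (auto simp: V_def)
      then have "\<not> 1 < s * ?d x" using L_1 by (meson less_asym)
      then obtain m' where "odd m'" "L m' (s * ?d x)" using \<open>x \<in> W\<close> by (auto simp: W_def)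
      then show False using m L_uniq by metis
    qed
    then show ?thesis by blast
  qed
  have zero: "?d x = 0" if "x \<in> F" for x using that by simp
  have VF: "V \<inter> F = {}" using L_pos zero by (force simp: V_def)
  have WF: "W \<inter> F = {}" using L_pos zero by (force simp: W_def)
  have cover: "T \<subseteq> V \<union> W \<union> F"
  proof
    fix t assume t: "t \<in> T"
    show "t \<in> V \<union> W \<union> F"
    proof (cases "t \<in> F")
      case False
      then have d: "?d t > 0" using infdist_pos_not_in_closed[OF clF F(2)] by blast
      have ne: "s * ?d t \<noteq> (1/2) ^ j" for j
      proof
        assume "s * ?d t = (1/2) ^ j"
        then have "s = (1/2) ^ j / ?d t" using d by (simp add: field_simps)
        then show False using s(2) t by (auto simp: bad_def)
      qed
      show ?thesis
      proof (cases "s * ?d t < 1")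
        case True
        then obtain m where "L m (s * ?d t)" using L_ex[of "s * ?d t"] ne d s(1) by auto
        then show ?thesis by (cases "even m") (auto simp: V_def W_def)
      next
        case False
        then have "1 < s * ?d t" using ne[of 0] by simp
        then show ?thesis by (simp add: W_def)
      qed
    qed simp
  qed
  have near: "\<exists>x m. dist x p < e \<and> even m = b \<and> L m (s * ?d x)" if p: "p \<in> F" and e: "e > 0" for p e b
  proof -
    obtain z where z: "dist z p < e" "z \<notin> F" using ball_minus_countable_nonempty[OF F(3) e] by blast
    have dz: "s * ?d z > 0" using infdist_pos_not_in_closed[OF clF F(2) z(2)] s(1) by simp
    obtain n where n: "(1/2::real) ^ n < s * ?d z" using real_arch_pow_inv[of "s * ?d z" "1/2"] dz by auto
    \<comment> \<open>Either parity is available at an index at least \<open>n\<close>, so shell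
      \<open>m\<close> is still closer to \<open>F\<close> than \<open>z\<close>.\<close>
    define m where "m = (if b then 2 * n else 2 * n + 1)"
    have "(1/2::real) ^ m \<le> (1/2) ^ n" by (rule power_decreasing) (auto simp: m_def)
    then have m: "(1/2::real) ^ m < s * ?d z" using n by linarith
    have pm: "(1/2::real) ^ m > 0" by simp
    have "connected ((\<lambda>x. s * ?d x) ` closed_segment p z)"
      by (intro connected_continuous_image continuous_intros connected_segment)
    moreover have "0 \<in> (\<lambda>x. s * ?d x) ` closed_segment p z"
      using zero[OF p] by (intro image_eqI[of _ _ p]) auto
    moreover have "s * ?d z \<in> (\<lambda>x. s * ?d x) ` closed_segment p z" by auto
    ultimately have "{0..s * ?d z} \<subseteq> (\<lambda>x. s * ?d x) ` closed_segment p z"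
      by (rule connected_contains_Icc)
    \<comment> \<open>This value is the midpoint of shell \<open>m\<close>; by connectedness some
      point between \<open>p\<close> and \<open>z\<close> has it as scaled distance.\<close>
    moreover have "3/4 * (1/2) ^ m \<in> {0..s * ?d z}" using m pm unfolding atLeastAtMost_iff by linarith
    ultimately have "3/4 * (1/2) ^ m \<in> (\<lambda>x. s * ?d x) ` closed_segment p z" by (rule subsetD)
    then obtain x where x: "3/4 * (1/2) ^ m = s * ?d x" "x \<in> closed_segment p z" by (rule imageE)
    have "dist x p \<le> dist z p" using segment_bound(1)[OF x(2)] by (simp add: dist_norm norm_minus_commute)
    moreover have "L m (s * ?d x)" unfolding L_def x(1)[symmetric] using pm by simp
    moreover have "even m = b" by (simp add: m_def)
    ultimately show ?thesis using z(1) by (meson le_less_trans)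
  qed
  have "F \<subseteq> closure V"
  proof
    fix p assume "p \<in> F"
    then show "p \<in> closure V" unfolding closure_approachable V_def using near[of p _ True] by blast
  qed
  moreover have "F \<subseteq> closure W"
  proof
    fix p assume "p \<in> F"
    then show "p \<in> closure W" unfolding closure_approachable W_def using near[of p _ False] by blast
  qed
  moreover have "?d x < 1" if xV: "x \<in> V" for x
  proof -
    obtain m where "L m (s * ?d x)" using xV by (auto simp: V_def)
    then have "s * ?d x < 1" by (rule L_1)
    moreover have "?d x \<le> s * ?d x" using s(1) infdist_nonneg[of x F] by (simp add: mult_le_cancel_right1)
    ultimately show ?thesis by linarith
  qed
  ultimately show ?thesis using that[of V W] oV oW VW VF WF cover by blast
qed

lemma closure_eq_UNIV_iff: "closure S = UNIV \<longleftrightarrow> (\<forall>U. open U \<and> U \<noteq> {} \<longrightarrow> S \<inter> U \<noteq> {})"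
proof
  assume "closure S = UNIV"
  then show "\<forall>U. open U \<and> U \<noteq> {} \<longrightarrow> S \<inter> U \<noteq> {}"
    using open_Int_closure_eq_empty[of _ S] by (metis Int_UNIV_right Int_commute)
next
  assume "\<forall>U. open U \<and> U \<noteq> {} \<longrightarrow> S \<inter> U \<noteq> {}"
  then have "- closure S = {}"
    using closure_subset[of S] by (metis Compl_disjoint closed_closure disjoint_iff open_Compl subsetD)
  then show "closure S = UNIV" by auto
qed

text \<open>Thinning \<open>T\<close> inside \<open>V\<close> to a countable dense subset makes it
  locally countable exactly there. At points of \<open>F\<close> the thinned part accumulates, while
  \<open>W\<close> keeps every neighbourhood uncountable, so the boundary is
  \<open>F \<inter> T\<close>. The quantifier over \<open>V'\<close> and \<open>A'\<close> allows
  for points received from a partner far away: they leave the code unchanged because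
  \<open>T\<close> is untouched, hence uncountable, in every nonempty open subset of
  \<open>V'\<close>.\<close>

lemma prescribed_cb_code:
  fixes T :: "real set" and N :: "nat set" and c :: real
  assumes T: "|T| <o |UNIV :: real set|" "\<And>V. open V \<Longrightarrow> V \<noteq> {} \<Longrightarrow> uncountable (T \<inter> V)"
    "\<And>V. open V \<Longrightarrow> V \<noteq> {} \<Longrightarrow> V - T \<noteq> {}"
  shows "\<exists>V A. open V \<and> V \<subseteq> {c - 1<..<c + 2} \<and> A \<subseteq> T \<inter> V \<and>
    (\<forall>V' A'. open V' \<and> V' \<inter> {c - 1<..<c + 2} = {} \<and> A' \<subseteq> V' \<longrightarrow>
      rank_code (countable_boundary ((T - A) \<union> A')) = Suc ` N \<and> closure ((T - A) \<union> A') = UNIV)"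
proof -
  have ne: "V \<inter> T \<noteq> {}" if "open V" "V \<noteq> {}" for V using T(2)[OF that] by (metis Int_commute countable_empty)
  obtain F where F: "rank_code (F \<inter> T) = Suc ` N" "compact F" "countable F" "F \<subseteq> {c<..<c + 1}" "F \<noteq> {}"
    using rank_code_realized[OF ne T(3), of "{c<..<c + 1}" N] by auto
  have "infinite T" using T(2)[of UNIV] uncountable_infinite by auto
  then obtain V W where VW: "open V" "open W" "V \<inter> W = {}" "V \<inter> F = {}" "W \<inter> F = {}" "T \<subseteq> V \<union> W \<union> F"
    "F \<subseteq> closure V" "F \<subseteq> closure W" "\<And>x. x \<in> V \<Longrightarrow> infdist x F < 1"
    using alternating_shells[OF F(2,5,3) T(1)] by metis
  have Vsub: "V \<subseteq> {c - 1<..<c + 2}"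
  proof
    fix x assume x: "x \<in> V"
    obtain a where a: "a \<in> F" "infdist x F = dist x a"
      using infdist_attains_inf[OF compact_imp_closed[OF F(2)] F(5), of x] by blast
    then have "dist x a < 1" using VW(9)[OF x] by simp
    moreover have "c < a" "a < c + 1" using a(1) F(4) by auto
    ultimately show "x \<in> {c - 1<..<c + 2}" by (auto simp: dist_real_def)
  qed
  obtain C where C: "countable C" "C \<subseteq> T \<inter> V" "T \<inter> V \<subseteq> closure C" using separable by blast
  define A where "A = T \<inter> V - C"
  have main: "rank_code (countable_boundary ((T - A) \<union> A')) = Suc ` N \<and> closure ((T - A) \<union> A') = UNIV"
    if V': "open V'" "V' \<inter> {c - 1<..<c + 2} = {}" "A' \<subseteq> V'" for V' A'
  proof -
    let ?S = "(T - A) \<union> A'"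
    have dV: "V' \<inter> V = {}" "V' \<inter> F = {}" using V'(2) Vsub F(4) by fastforce+
    have SV: "?S \<inter> V = C" using C(2) dV V'(3) by (auto simp: A_def)
    have out: "T - V \<subseteq> ?S" by (auto simp: A_def)
    \<comment> \<open>A neighbourhood containing a nonempty open set off \<open>V\<close> contains
      uncountably many untouched points of \<open>T\<close>.\<close>
    have unc: "x \<notin> countable_points ?S" if x: "\<And>U. open U \<Longrightarrow> x \<in> U \<Longrightarrow> \<exists>G. open G \<and> G \<noteq> {} \<and> G \<subseteq> U - V" for x
    proof
      assume "x \<in> countable_points ?S"
      then obtain U where U: "open U" "x \<in> U" "countable (U \<inter> ?S)" by (auto simp: countable_points_def)
      then obtain G where G: "open G" "G \<noteq> {}" "G \<subseteq> U - V" using x by blast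
      have "T \<inter> G \<subseteq> U \<inter> ?S" using G(3) out by blast
      then show False using T(2)[OF G(1,2)] U(3) countable_subset by blast
    qed
    have cp: "countable_points ?S = C"
    proof (intro equalityI subsetI)
      fix x assume "x \<in> C"
      then have "x \<in> ?S" "x \<in> V" using SV by blast+
      moreover have "countable (V \<inter> ?S)" using SV C(1) by (simp add: Int_commute)
      ultimately show "x \<in> countable_points ?S" using VW(1) by (auto simp: countable_points_def)
    next
      fix x assume x: "x \<in> countable_points ?S"
      then have xS: "x \<in> ?S" by (simp add: countable_points_def)
      show "x \<in> C"
      proof (cases "x \<in> V")
        case True
        then show ?thesis using SV xS by blast
      next
        case False
        have "x \<in> W \<union> F \<union> V'" using xS VW(6) V'(3) False by blast
        then have "\<exists>G. open G \<and> G \<noteq> {} \<and> G \<subseteq> U - V" if "open U" "x \<in> U" for U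
        proof (elim UnE)
          assume "x \<in> W"
          then show ?thesis using that VW(2,3) by (intro exI[of _ "U \<inter> W"]) auto
        next
          assume "x \<in> F"
          then have "x \<in> closure W" using VW(8) by blast
          then have "U \<inter> W \<noteq> {}" using that open_Int_closure_eq_empty[of U W] by blast
          then show ?thesis using that VW(2,3) by (intro exI[of _ "U \<inter> W"]) auto
        next
          assume "x \<in> V'"
          then show ?thesis using that V'(1) dV(1) by (intro exI[of _ "U \<inter> V'"]) auto
        qed
        then show ?thesis using unc x by blast
      qed
    qed
    have clC: "closure C = closure V"
    proof
      show "closure C \<subseteq> closure V" using C(2) by (intro closure_mono) blast
      have "V \<subseteq> closure (T \<inter> V)"
      proof
        fix x assume x: "x \<in> V"
        show "x \<in> closure (T \<inter> V)"
        proof (rule ccontr)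
          assume "x \<notin> closure (T \<inter> V)"
          then have "V - closure (T \<inter> V) \<noteq> {}" "open (V - closure (T \<inter> V))" using x VW(1) by auto
          then have "T \<inter> (V - closure (T \<inter> V)) \<noteq> {}" using ne by blast
          then show False using closure_subset[of "T \<inter> V"] by blast
        qed
      qed
      also have "\<dots> \<subseteq> closure C" using C(3) by (rule closure_minimal) simp
      finally show "closure V \<subseteq> closure C" by (rule closure_minimal) simp
    qed
    have "countable_boundary ?S = F \<inter> T"
    proof (intro equalityI subsetI)
      fix x assume x: "x \<in> countable_boundary ?S"
      then have x': "x \<in> ?S" "x \<notin> C" "x \<in> closure V" unfolding countable_boundary_def cp clC by auto
      have "x \<notin> V" using x' SV by blast
      moreover have "x \<notin> W" using x'(3) open_Int_closure_eq_empty[OF VW(2), of V] VW(3) by blast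
      moreover have "x \<notin> V'" using x'(3) open_Int_closure_eq_empty[OF V'(1), of V] dV(1) by blast
      ultimately show "x \<in> F \<inter> T" using x'(1) VW(6) V'(3) by blast
    next
      fix x assume x: "x \<in> F \<inter> T"
      then have "x \<in> ?S" "x \<notin> C" using VW(4) out C(2) by blast+
      moreover have "x \<in> closure C" using x VW(7) clC by blast
      ultimately show "x \<in> countable_boundary ?S" unfolding countable_boundary_def cp by blast
    qed
    moreover have "closure ?S = UNIV"
    proof -
      have "closure C \<subseteq> closure ?S" using SV by (intro closure_mono) blast
      then have "T \<inter> V \<subseteq> closure ?S" using C(3) by blast
      then have "T \<subseteq> closure ?S" using out closure_subset[of ?S] by blast
      then have "closure T \<subseteq> closure ?S" by (rule closure_minimal) (rule closed_closure)
      moreover have "closure T = UNIV" unfolding closure_eq_UNIV_iff using ne by (metis Int_commute)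
      ultimately show ?thesis by blast
    qed
    ultimately show ?thesis using F(1) by simp
  qed
  show ?thesis
  proof (rule exI[of _ V], rule exI[of _ A], intro conjI allI impI)
    show "open V" "V \<subseteq> {c - 1<..<c + 2}" by (rule VW(1) Vsub)+
    show "A \<subseteq> T \<inter> V" by (auto simp: A_def)
    fix V' A' assume "open V' \<and> V' \<inter> {c - 1<..<c + 2} = {} \<and> A' \<subseteq> V'"
    then have *: "open V'" "V' \<inter> {c - 1<..<c + 2} = {}" "A' \<subseteq> V'" by blast+
    show "rank_code (countable_boundary ((T - A) \<union> A')) = Suc ` N" by (rule main[OF *, THEN conjunct1])
    show "closure ((T - A) \<union> A') = UNIV" by (rule main[OF *, THEN conjunct2])
  qed
qed

lemma real_nonhomeomorphic_rearrangement:
  fixes T :: "nat set \<times> bool \<Rightarrow> real set" and \<kappa> :: "'k rel"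
  assumes \<kappa>: "Card_order \<kappa>" "natLeq <o \<kappa>" "\<kappa> <o |UNIV :: real set|"
    and T: "\<And>x. \<exists>!i. x \<in> T i" "\<And>i. card_dense \<kappa> (T i)"
  obtains S where "\<And>i. \<exists>j. S i \<subseteq> T i \<union> T j" "\<And>x. \<exists>!i. x \<in> S i" "\<And>i. closure (S i) = UNIV"
    "\<And>i. |S i| =o \<kappa>" "\<And>i j. i \<noteq> j \<Longrightarrow> \<not> S i homeomorphic S j"
proof -
  have unc: "uncountable A" if "|A| =o \<kappa>" for A :: "real set"
  proof
    assume "countable A"
    then have "|A| \<le>o natLeq" using countable_ordLeq card_of_nat ordLeq_ordIso_trans by blast
    then have "\<kappa> \<le>o natLeq" using that ordIso_symmetric ordIso_ordLeq_trans by blast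
    then show False using \<kappa>(2) not_ordLess_ordLeq by blast
  qed
  have cT: "|T i \<inter> V| =o \<kappa>" if "open V" "V \<noteq> {}" for i V
    using T(2)[of i] that unfolding card_dense_def by blast
  have cT': "|T i| =o \<kappa>" for i using cT[of UNIV i] by simp
  have T1: "|T i| <o |UNIV :: real set|" for i using cT' \<kappa>(3) by (rule ordIso_ordLess_trans)
  have T2: "uncountable (T i \<inter> V)" if "open V" "V \<noteq> {}" for i V using unc[OF cT[OF that]] .
  define opp where "opp = (\<lambda>i :: nat set \<times> bool. (fst i, \<not> snd i))"
  have opp: "opp (opp i) = i" "opp i \<noteq> i" for i by (cases i; simp add: opp_def)+
  have disj: "T i \<inter> T j = {}" if "i \<noteq> j" for i j using T(1) that by blast
  have T3: "V - T i \<noteq> {}" if V: "open V" "V \<noteq> {}" for i V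
  proof -
    have "T (opp i) \<inter> V \<noteq> {}" using T2[OF V, of "opp i"] by (metis countable_empty)
    then obtain x where "x \<in> T (opp i)" "x \<in> V" by blast
    then show ?thesis using disj[OF opp(2)[of i]] by blast
  qed
  \<comment> \<open>The windows \<open>(-1, 2)\<close> and \<open>(9, 12)\<close> of the two
    partners are disjoint, so the points a tile receives lie away from the window in which its own
    code is made.\<close>
  define c where "c = (\<lambda>i :: nat set \<times> bool. if snd i then 10 else 0 :: real)"
  \<comment> \<open>Even numbers encode \<open>fst i\<close> and the odd number 1 encodes
    \<open>snd i\<close>, so \<open>N\<close> is injective.\<close>
  define N where "N = (\<lambda>i :: nat set \<times> bool. (\<lambda>n. 2 * n) ` fst i \<union> (if snd i then {1} else {}))"
  have "\<forall>i. \<exists>V A. open V \<and> V \<subseteq> {c i - 1<..<c i + 2} \<and> A \<subseteq> T i \<inter> V \<and>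
    (\<forall>V' A'. open V' \<and> V' \<inter> {c i - 1<..<c i + 2} = {} \<and> A' \<subseteq> V' \<longrightarrow>
      rank_code (countable_boundary ((T i - A) \<union> A')) = Suc ` N i \<and> closure ((T i - A) \<union> A') = UNIV)"
    using prescribed_cb_code[OF T1 T2 T3] by (intro allI)
  then obtain V A where VA: "\<And>i. open (V i)" "\<And>i. V i \<subseteq> {c i - 1<..<c i + 2}" "\<And>i. A i \<subseteq> T i \<inter> V i"
    "\<And>i V' A'. open V' \<Longrightarrow> V' \<inter> {c i - 1<..<c i + 2} = {} \<Longrightarrow> A' \<subseteq> V' \<Longrightarrow>
      rank_code (countable_boundary ((T i - A i) \<union> A')) = Suc ` N i \<and> closure ((T i - A i) \<union> A') = UNIV"
    by metis
  define S where "S = (\<lambda>i. (T i - A i) \<union> A (opp i))"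
  have far: "V (opp i) \<inter> {c i - 1<..<c i + 2} = {}" for i
    using VA(2)[of "opp i"] by (cases "snd i") (fastforce simp: c_def opp_def)+
  have props: "rank_code (countable_boundary (S i)) = Suc ` N i \<and> closure (S i) = UNIV" for i
    unfolding S_def using VA(4)[OF VA(1) far] VA(3)[of "opp i"] by blast
  have sub: "S i \<subseteq> T i \<union> T (opp i)" for i using VA(3)[of "opp i"] unfolding S_def by blast
  have cinf: "Cinfinite \<kappa>" using \<kappa>(1,2) cinfinite_mono natLeq_cinfinite ordLess_imp_ordLeq by blast
  have card: "|S i| =o \<kappa>" for i
  proof -
    have "|T i \<union> T (opp i)| \<le>o \<kappa>" by (intro Un_Cinfinite_bound ordIso_imp_ordLeq[OF cT'] cinf)
    then have 1: "|S i| \<le>o \<kappa>" by (rule ordLeq_transitive[OF card_of_mono1[OF sub]])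
    \<comment> \<open>Both windows lie to the left of 20; beyond it \<open>T i\<close> is intact and
      already contributes \<kappa> points.\<close>
    have "T i \<inter> {20<..} \<subseteq> S i"
      using VA(2,3)[of i] by (fastforce simp: S_def c_def split: if_splits)
    then have 2: "|T i \<inter> {20<..}| \<le>o |S i|" by (rule card_of_mono1)
    have "|T i \<inter> {20<..}| =o \<kappa>" by (rule cT) auto
    then have "\<kappa> \<le>o |S i|" by (rule ordIso_ordLeq_trans[OF ordIso_symmetric 2])
    then show ?thesis using 1 by (simp add: ordIso_iff_ordLeq)
  qed
  show ?thesis
  proof (rule that[of S])
    show "\<exists>j. S i \<subseteq> T i \<union> T j" for i using sub by blast
    show "closure (S i) = UNIV" for i using props by blast
    show "|S i| =o \<kappa>" for i by (rule card)
    show "\<exists>!i. x \<in> S i" for x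
    proof -
      obtain i where i: "x \<in> T i" using T(1) by blast
      have iff: "x \<in> T j \<longleftrightarrow> j = i" for j using i disj by blast
      have Aiff: "x \<in> A j \<longleftrightarrow> j = i \<and> x \<in> A i" for j using VA(3)[of j] iff[of j] by blast
      have "x \<in> S j \<longleftrightarrow> j = (if x \<in> A i then opp i else i)" for j
      proof -
        have "opp j = i \<longleftrightarrow> j = opp i" using opp(1) by metis
        then show ?thesis unfolding S_def using iff[of j] Aiff[of j] Aiff[of "opp j"] opp(2)[of i] by auto
      qed
      then show ?thesis by simp
    qed
    show "\<not> S i homeomorphic S j" if "i \<noteq> j" for i j
    proof
      assume "S i homeomorphic S j"
      then have "Suc ` N i = Suc ` N j"
        using homeomorphic_cb_code[OF homeomorphic_countable_boundary] props by metis
      then have eq: "N i = N j" by (simp add: inj_image_eq_iff)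
      have 1: "snd i \<longleftrightarrow> 1 \<in> N i" and 2: "n \<in> fst i \<longleftrightarrow> 2 * n \<in> N i" for i n
        by (auto simp: N_def)
      have "snd i = snd j" using 1[of i] 1[of j] eq by simp
      moreover have "fst i = fst j" using 2[of _ i] 2[of _ j] eq by (intro set_eqI) simp
      ultimately show False using that by (simp add: prod_eq_iff)
    qed
  qed
qed

text \<open>The tiles and the ideal live in the original group and only the rearrangement takes
  place in the reals. The pieces pulled back lie in the ideal since each is covered by two
  tiles.\<close>

lemma real_line_nonhomeomorphic_partition:
  fixes \<kappa> :: "'k rel" and \<L> :: "'a::{topological_ab_group_add, t2_space} set set"
  assumes real: "is_real_line TYPE('a)"
    and \<kappa>: "Card_order \<kappa>" "natLeq <o \<kappa>" "\<kappa> <o |UNIV :: nat set set|"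
    and \<L>: "sigma_ideal \<L>" "translation_invariant \<L>"
    and B: "B \<in> \<L>" "card_dense \<kappa> B"
    and X: "|X| =o |UNIV :: nat set set|" "\<And>h. \<exists>!x. x \<in> X \<and> h - x \<in> B"
  shows "\<exists>\<P> \<subseteq> \<L>. partition_on UNIV \<P> \<and> (\<forall>S\<in>\<P>. closure S = UNIV \<and> |S| =o \<kappa>) \<and> |\<P>| =o continuum \<and>
    (\<forall>S\<in>\<P>. \<forall>T\<in>\<P>. S \<noteq> T \<longrightarrow> \<not> S homeomorphic T)"
proof -
  obtain f :: "'a \<Rightarrow> real" where f: "homeomorphic_map euclidean euclidean f"
    using real unfolding is_real_line_def by blast
  have surj: "surj f" using homeomorphic_imp_surjective_map[OF f] by simp
  have inj: "inj f" using homeomorphic_imp_injective_map[OF f] by simp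
  have cont: "continuous_on UNIV f" using homeomorphic_imp_continuous_map[OF f] by simp
  have opn: "open (f ` U)" if "open U" for U
    using homeomorphic_imp_open_map[OF f] that by (auto simp: open_map_def)
  have hom: "homeomorphism UNIV UNIV f (inv f)"
    unfolding homeomorphism_def
  proof (intro conjI ballI)
    have "inv f -` U = f ` U" for U
    proof (intro equalityI subsetI)
      fix x assume "x \<in> inv f -` U"
      then show "x \<in> f ` U" using surj_f_inv_f[OF surj, of x] by (metis imageI vimageD)
    qed (use inj in auto)
    then show "continuous_on UNIV (inv f)" using opn by (simp add: continuous_on_open_vimage)
  qed (use cont inj surj in \<open>simp_all add: surj_f_inv_f inj_imp_surj_inv\<close>)
  have cardI: "|UNIV :: (nat set \<times> bool) set| =o |UNIV :: nat set set|"
    by (rule card_of_continuum_Times) simp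
  obtain g :: "nat set \<times> bool \<Rightarrow> 'a" where g: "\<And>h. \<exists>!j. h \<in> (+) (g j) ` B"
    by (rule reindex_translates[OF X(2) ordIso_transitive[OF X(1) ordIso_symmetric[OF cardI]]]) (rule that)
  define T where "T = (\<lambda>i. (+) (g i) ` B)"
  have TL: "T i \<in> \<L>" for i using \<L>(2) B(1) by (auto simp: T_def translation_invariant_def)
  have card_real: "\<kappa> <o |UNIV :: real set|"
  proof -
    have "(UNIV :: nat set set) \<lesssim> (UNIV :: real set)"
      using nat_sets_eqpoll_reals eqpoll_imp_lepoll by blast
    then show ?thesis using \<kappa>(3) ordLess_ordLeq_trans unfolding lepoll_iff_card_of_ordLeq by blast
  qed
  have uniq: "\<exists>!i. x \<in> f ` T i" for x
  proof -
    obtain z where z: "x = f z" using surj by blast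
    have "x \<in> f ` T i \<longleftrightarrow> z \<in> T i" for i unfolding z by (rule inj_image_mem_iff[OF inj])
    then show ?thesis using g[of z] unfolding T_def by simp
  qed
  have card_img: "|f ` A| =o |A|" for A
    using card_of_ordIso inj by (metis bij_betw_imageI inj_on_subset ordIso_symmetric subset_UNIV)
  have dense: "card_dense \<kappa> (f ` T i)" for i
    unfolding card_dense_def
  proof (intro allI impI)
    fix U :: "real set" assume U: "open U \<and> U \<noteq> {}"
    have "open (f -` U)" using U cont by (simp add: open_vimage)
    moreover have "f -` U \<noteq> {}" using U surj by (metis all_not_in_conv surjD vimageI2)
    ultimately have "|T i \<inter> f -` U| =o \<kappa>"
      using card_dense_translate[OF B(2), of "g i"] unfolding T_def card_dense_def by blast
    moreover have "f ` T i \<inter> U = f ` (T i \<inter> f -` U)" by blast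
    ultimately show "|f ` T i \<inter> U| =o \<kappa>" using card_img[of "T i \<inter> f -` U"] ordIso_transitive by simp
  qed
  obtain S where S: "\<And>i. \<exists>j. S i \<subseteq> f ` T i \<union> f ` T j" "\<And>x. \<exists>!i. x \<in> S i" "\<And>i. closure (S i) = UNIV"
    "\<And>i. |S i| =o \<kappa>" "\<And>i j. i \<noteq> j \<Longrightarrow> \<not> S i homeomorphic S j"
    by (rule real_nonhomeomorphic_rearrangement[OF \<kappa>(1,2) card_real uniq dense]) (rule that)
  define Q where "Q = (\<lambda>i. f -` S i)"
  have fQ: "f ` Q i = S i" for i using surj by (simp add: Q_def)
  have Qhom: "Q i homeomorphic S i" for i
    using homeomorphism_of_subsets[OF hom subset_UNIV subset_UNIV fQ] unfolding homeomorphic_def by blast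
  have Quniq: "\<exists>!i. x \<in> Q i" for x using S(2)[of "f x"] by (simp add: Q_def)
  have Qne: "Q i \<noteq> {}" for i using S(3)[of i] fQ[of i] by auto
  show ?thesis
  proof (intro exI[of _ "range Q"] conjI)
    have "Q i \<in> \<L>" for i
    proof -
      obtain j where "S i \<subseteq> f ` T i \<union> f ` T j" using S(1) by blast
      then have "Q i \<subseteq> T i \<union> T j" using inj by (auto simp: Q_def inj_def)
      then show ?thesis by (rule sigma_ideal_subset[OF \<L>(1) sigma_ideal_Un[OF \<L>(1) TL TL]])
    qed
    then show "range Q \<subseteq> \<L>" by blast
    show "partition_on UNIV (range Q)" by (rule partition_on_range(1)[OF Quniq Qne])
    show "|range Q| =o continuum"
      by (rule ordIso_transitive[OF ordIso_transitive[OF partition_on_range(2)[OF Quniq Qne] cardI]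
            ordIso_symmetric[OF continuum_ordIso]])
    show "\<forall>S\<in>range Q. closure S = UNIV \<and> |S| =o \<kappa>"
    proof (intro ballI conjI)
      fix A assume "A \<in> range Q"
      then obtain i where A: "A = Q i" by blast
      show "closure A = UNIV"
        unfolding closure_eq_UNIV_iff
      proof (intro allI impI)
        fix U :: "'a set" assume U: "open U \<and> U \<noteq> {}"
        then have "S i \<inter> f ` U \<noteq> {}" using S(3)[of i] opn[of U] unfolding closure_eq_UNIV_iff by blast
        then show "A \<inter> U \<noteq> {}" by (auto simp: A Q_def)
      qed
      show "|A| =o \<kappa>"
        using card_img[of "Q i"] S(4)[of i] ordIso_symmetric ordIso_transitive unfolding A fQ by blast
    qed
    show "\<forall>A\<in>range Q. \<forall>C\<in>range Q. A \<noteq> C \<longrightarrow> \<not> A homeomorphic C"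
    proof (intro ballI impI notI)
      fix A C assume AC: "A \<in> range Q" "C \<in> range Q" "A \<noteq> C" "A homeomorphic C"
      then obtain i j where ij: "A = Q i" "C = Q j" by (elim imageE) (rule that)
      then have "i \<noteq> j" using AC(3) by auto
      have "S i homeomorphic Q i" using Qhom homeomorphic_sym by blast
      then have "S i homeomorphic Q j" using AC(4) unfolding ij by (rule homeomorphic_trans)
      then have "S i homeomorphic S j" using Qhom by (rule homeomorphic_trans)
      then show False using S(5)[OF \<open>i \<noteq> j\<close>] by blast
    qed
  qed
qed

theorem theorem8:
  fixes \<kappa> :: "'k rel"
    and \<L> :: "'a::{polish_space, topological_ab_group_add} set set"
  assumes "in_class_P TYPE('a) \<or> is_K_power_aleph0 TYPE('a)"
    and "Card_order \<kappa>" and "natLeq \<le>o \<kappa>"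
    and "sigma_ideal \<L>"
    and "translation_invariant \<L>"
    and "\<And>U :: 'a set. open U \<Longrightarrow> U \<noteq> {} \<Longrightarrow> \<exists>L\<in>\<L>. L \<subseteq> U \<and> |L| =o \<kappa>"
  shows
    "(\<exists>\<P> \<subseteq> \<L>. partition_on UNIV \<P> \<and>
        (\<forall>S\<in>\<P>. card_dense \<kappa> S) \<and>
        |\<P>| =o continuum \<and>
        (\<forall>S\<in>\<P>. \<forall>T\<in>\<P>. S homeomorphic T) \<and>
        (\<exists>L\<in>\<L>. \<exists>X. \<P> = {(+) x ` L |x. x \<in> X}))
     \<and>
     (continuum <o ctwo ^c \<kappa> \<longrightarrow>
        (\<exists>\<P> \<subseteq> \<L>. partition_on UNIV \<P> \<and>
           (\<forall>S\<in>\<P>. card_dense \<kappa> S) \<and>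
           |\<P>| =o continuum \<and>
           (\<forall>S\<in>\<P>. \<forall>T\<in>\<P>. S \<noteq> T \<longrightarrow> \<not> S homeomorphic T)))
     \<and>
     (\<kappa> =o continuum \<longrightarrow> continuum <o ctwo ^c \<kappa>)
     \<and>
     (is_real_line TYPE('a) \<and> natLeq <o \<kappa> \<longrightarrow>
        (\<exists>\<P> \<subseteq> \<L>. partition_on UNIV \<P> \<and>
           (\<forall>S\<in>\<P>. closure S = UNIV \<and> |S| =o \<kappa>) \<and>
           |\<P>| =o continuum \<and>
           (\<forall>S\<in>\<P>. \<forall>T\<in>\<P>. S \<noteq> T \<longrightarrow> \<not> S homeomorphic T)))"
proof -
  have half: "countable {x::'a. x + x = y}" for y
    using assms(1) in_class_P_halves is_K_power_aleph0_halves by blast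
  have c: "|UNIV :: nat set set| \<le>o |UNIV :: 'a set|"
    using assms(1) in_class_P_continuum_le is_K_power_aleph0_continuum_le by blast
  obtain B0 B1 X where B: "B0 \<union> B1 \<in> \<L>" "B0 \<inter> B1 = {}" "card_dense \<kappa> B0" "card_dense \<kappa> B1"
    "|B0 \<union> B1| =o \<kappa>" and X: "|X| =o |UNIV :: nat set set|" "\<And>h::'a. \<exists>!x. x \<in> X \<and> h - x \<in> B0 \<union> B1"
    by (rule card_dense_tile_exists[OF half c assms(2-6)]) (assumption+, rule that)
  have dB: "card_dense \<kappa> (B0 \<union> B1)"
    by (rule card_dense_superset[OF B(3) Un_upper1 ordIso_imp_ordLeq[OF B(5)]])
  have big: "continuum <o ctwo ^c \<kappa>" if "\<kappa> =o continuum"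
    using ordIso_symmetric[OF that] ordLess_ctwo_cexp[OF assms(2)] by (rule ordIso_ordLess_trans)
  note nonhom = nonhomeomorphic_partition[OF assms(2-5) B X]
  have real: "\<exists>\<P> \<subseteq> \<L>. partition_on UNIV \<P> \<and> (\<forall>S\<in>\<P>. closure S = UNIV \<and> |S| =o \<kappa>) \<and> |\<P>| =o continuum \<and>
           (\<forall>S\<in>\<P>. \<forall>T\<in>\<P>. S \<noteq> T \<longrightarrow> \<not> S homeomorphic T)"
    if r: "is_real_line TYPE('a)" "natLeq <o \<kappa>"
  proof (cases "\<kappa> <o |UNIV :: nat set set|")
    case True
    show ?thesis by (rule real_line_nonhomeomorphic_partition[OF r(1) assms(2) r(2) True assms(4,5) B(1) dB X])
  next
    case False
    \<comment> \<open>The tile has \<kappa> elements, so \<kappa> is now exactly the continuum. Thus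
      (ii) applies, and \<kappa>-dense sets are dense and of size \<kappa>.\<close>
    have "|B0 \<union> B1| \<le>o |UNIV :: nat set set|"
      using card_of_mono1[OF subset_UNIV] card_of_second_countable_t2 by (rule ordLeq_transitive)
    then have "\<kappa> \<le>o |UNIV :: nat set set|"
      by (rule ordIso_ordLeq_trans[OF ordIso_symmetric[OF B(5)]])
    then have "\<kappa> =o |UNIV :: nat set set|" using False ordLeq_iff_ordLess_or_ordIso by blast
    then have "\<kappa> =o continuum" using ordIso_symmetric[OF continuum_ordIso] by (rule ordIso_transitive)
    then obtain \<P> where P: "\<P> \<subseteq> \<L>" "partition_on UNIV \<P>" "\<forall>S\<in>\<P>. card_dense \<kappa> S" "|\<P>| =o continuum"
      "\<forall>S\<in>\<P>. \<forall>T\<in>\<P>. S \<noteq> T \<longrightarrow> \<not> S homeomorphic T"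
      using nonhom[OF big] by blast
    have "closure S = UNIV \<and> |S| =o \<kappa>" if "S \<in> \<P>" for S
    proof
      have d: "card_dense \<kappa> S" using P(3) that by blast
      then have S: "|S \<inter> U| =o \<kappa>" if "open U" "U \<noteq> {}" for U using that by (simp add: card_dense_def)
      show "|S| =o \<kappa>" using S[of UNIV] by simp
      have "S \<inter> U \<noteq> {}" if U: "open U" "U \<noteq> {}" for U
      proof
        assume "S \<inter> U = {}"
        then have "|{} :: 'a set| =o \<kappa>" using S[OF U] by simp
        then have "|{} :: 'a set| =o |S|" using ordIso_symmetric[OF \<open>|S| =o \<kappa>\<close>] by (rule ordIso_transitive)
        then have "S = {}" by (metis card_of_empty3 ordIso_iff_ordLeq)
        then show False using card_dense_nonempty[OF d assms(3)] by blast
      qed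
      then show "closure S = UNIV" unfolding closure_eq_UNIV_iff by blast
    qed
    then show ?thesis using P by (intro exI[of _ \<P>]) blast
  qed
  show ?thesis
    using homogeneous_partition[OF assms(3,5) B(1) dB X] nonhom big real by blast
qed

end
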